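(* Consider the two-stage stochastic mixed-integer program (P) with second-stage value functions $f^\omega$ ($\omega\in\Omega$), and the Lagrangian-cut decomposition algorithm (A) for it, both defined in the context. When the tolerance is $\epsilon=0$, algorithm (A) terminates after a finite number of iterations and outputs an optimal solution to (P); that is, the output $z^*$ is the shut-off component of an optimal solution $(x,z,\theta,P^L,P^G)$ of (P).
   Context: **Data.** $\mathcal B,\mathcal G,\mathcal D$ are finite sets of buses, generators and loads. $\mathcal L$ is a finite set of lines $(i,j)$ with $i,j\in\mathcal B$. $\mathcal C=\mathcal B\cup\mathcal G\cup\mathcal L$ (disjoint union) is the set of components. $\mathcal T=\{1,\dots,T\}$ is the set of time periods. $\mathcal G_i,\mathcal D_i,\mathcal L_i$ denote the generators, loads and lines attached to bus $i$; each generator and each load is attached to exactly one bus. $\Omega$ is a finite scenario set with probabilities $p^\omega\ge 0$, $\sum_{\omega}p^\omega=1$. Real parameters: demands $D_{dt}$; priorities $w_d\ge 0$; damage costs $r_c\ge0$; generation limits $\underline P^G_g\le \bar P^G_g$; thermal limits $W_{ij}\ge 0$; susceptances $b_{ij}\le 0$; big-M angle constants $\underline\theta\le 0\le\bar\theta$. Each scenario $\omega$ carries data $\xi^\omega=(\tau^\omega,v^\omega,u^\omega,I^\omega)$: a disruption time $\tau^\omega\in\{2,\dots,T+1\}$ (with $\tau^\omega=T+1$ meaning no disruption within the horizon, in which case $u^\omega=v^\omega=0$), vectors $u^\omega,v^\omega\in\{0,1\}^{\mathcal C}$, and sets $I^\omega_c\subseteq\mathcal C$ for $c\in\mathcal C$.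 **First-stage problem (P).** The variables are, for $t\in\mathcal T$, real $\theta_{it}$ ($i\in\mathcal B$), $P^L_{ijt}$ ($(i,j)\in\mathcal L$), $P^G_{gt}$ ($g\in\mathcal G$), $x_{dt}\in[0,1]$ ($d\in\mathcal D$), and binary $z_{ct}$ ($c\in\mathcal C$). $$Z^*=\min\ \sum_{\omega\in\Omega}p^\omega\Big[\sum_{t=1}^{\tau^\omega-1}\sum_{d\in\mathcal D}w_d(1-x_{dt})+f^\omega(z_{\cdot,\tau^\omega-1},\xi^\omega)\Big]$$ subject to, for all $t\in\mathcal T$: - $P^L_{ijt}\le -b_{ij}(\theta_{it}-\theta_{jt}+\bar\theta(1-z_{ijt}))$ and $P^L_{ijt}\ge -b_{ij}(\theta_{it}-\theta_{jt}+\underline\theta(1-z_{ijt}))$, for $(i,j)\in\mathcal L$; - $-W_{ij}z_{ijt}\le P^L_{ijt}\le W_{ij}z_{ijt}$, for $(i,j)\in\mathcal L$; - $\sum_{g\in\mathcal G_i}P^G_{gt}+\sum_{l\in\mathcal L_i}P^L_{lt}=\sum_{d\in\mathcal D_i}D_{dt}x_{dt}$, for $i\in\mathcal B$, where in the balance at bus $i$ the flow on a line $l\in\mathcal L_i$ is counted as flow into $i$, i.e. $P^L_{jit}$ enters the balance at $i$ with sign $+$ and $P^L_{ijt}$ with sign $-$; - $\underline P^G_g z_{gt}\le P^G_{gt}\le\bar P^G_g z_{gt}$, for $g\in\mathcal G$; - $z_{it}\ge x_{dt}$ for $i\in\mathcal B$, $d\in\mathcal D_i$; $z_{it}\ge z_{gt}$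 for $i\in\mathcal B$, $g\in\mathcal G_i$; $z_{it}\ge z_{ijt}$ for $(i,j)\in\mathcal L$; $z_{it}\ge z_{jit}$ for $(j,i)\in\mathcal L$; - $z_{ct}\ge z_{c,\min\{t+1,T\}}$ and $z_{ct}\in\{0,1\}$, for $c\in\mathcal C$. **Second-stage problem.** For $\hat z\in\{0,1\}^{\mathcal C}$, $$f^\omega(\hat z,\xi^\omega)=\min\ \sum_{t=\tau^\omega}^{T}\sum_{d\in\mathcal D}w_d(1-x^\omega_{dt})+\sum_{c\in\mathcal C}r_c\eta^\omega_c$$ over real $\theta^\omega_{it},P^{L,\omega}_{ijt},P^{G,\omega}_{gt}$, $x^\omega_{dt}\in[0,1]$ for $t\in\{\tau^\omega,\dots,T\}$, and binary $y^\omega_c,\eta^\omega_c,z^\omega_c$ ($c\in\mathcal C$), subject to: - (i) for all $t\in\{\tau^\omega,\dots,T\}$, the same line-flow, thermal-limit, balance and generation-limit constraints as in (P), and $y^\omega_i\ge x^\omega_{dt}$ ($d\in\mathcal D_i$), with $(\theta,P^L,P^G,x)$ replaced by their $\omega$-counterparts and $z_{ct}$ replaced by $y^\omega_c$ (which does not depend on $t$); - (ii) $y^\omega_i\ge y^\omega_g$ ($g\in\mathcal G_i$), $y^\omega_i\ge y^\omega_{ij}$ ($(i,j)\in\mathcal L$), $y^\omega_i\ge y^\omega_{ji}$ ($(j,i)\in\mathcal L$); - (iii) $y^\omega_c\le z^\omega_c$, $y^\omega_c\le 1-\eta^\omega_c$, $\eta^\omega_c\ge v^\omega_c$ for all $c\in\mathcal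 C$, and $\eta^\omega_k\ge u^\omega_c z^\omega_c$ for all $c\in\mathcal C$, $k\in I^\omega_c$; - (iv) (nonanticipativity) $z^\omega_c=\hat z_c$ for all $c\in\mathcal C$. **Lagrangian relaxation and dual.** For $\hat z\in\{0,1\}^{\mathcal C}$ and $\lambda\in\mathbb R^{\mathcal C}$, let $$R^\omega(\hat z,\lambda)=\min\ \sum_{t=\tau^\omega}^{T}\sum_{d\in\mathcal D}w_d(1-x^\omega_{dt})+\sum_{c\in\mathcal C}\big[r_c\eta^\omega_c+\lambda_c(\hat z_c-z^\omega_c)\big]$$ over the same variables (with the same binary restrictions) subject to (i)–(iii) only, i.e. with (iv) dropped. The Lagrangian dual problem is $\max_{\lambda\in\mathbb R^{\mathcal C}}R^\omega(\hat z,\lambda)$. **Master problem $(M_\ell)$.** Minimize $\sum_{\omega\in\Omega}p^\omega\big[\sum_{t=1}^{\tau^\omega-1}\sum_{d\in\mathcal D}w_d(1-x_{dt})+V^\omega\big]$ over the first-stage variables satisfying all constraints of (P) (including binarity of $z$) and real variables $V^\omega\ge 0$ satisfying the cuts $$V^\omega\ge v^{\omega,m}+(\lambda^{\omega,m})^\top(z_{\cdot,\tau^\omega-1}-\hat z^{m}_{\cdot,\tau^\omega-1}),\qquad \omega\in\Omega,\ m=1,\dots,\ell-1.$$ Its optimal value is denoted $Z^*_\ell$. **Algorithm (A)** with tolerance $\epsilon\ge0$. Initialize $\ell=1$, $LB=0$, $UB=\infty$. While $UB=\infty$ or $UB-LB>\epsilon\,UB$, do: 1. Solve $(M_\ell)$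 to optimality; obtain an optimal solution with shut-off part $\hat z^\ell$ and values $\hat V^{\omega,\ell}$, and the optimal value $Z^*_\ell$. Set $LB=Z^*_\ell$. 2. For each $\omega\in\Omega$, compute $f^\omega(\hat z^\ell_{\cdot,\tau^\omega-1},\xi^\omega)$. Set $\bar Z=Z^*_\ell+\sum_{\omega}p^\omega\big(f^\omega(\hat z^\ell_{\cdot,\tau^\omega-1},\xi^\omega)-\hat V^{\omega,\ell}\big)$. If $\bar Z<UB$, set $UB=\bar Z$ and $z^*=\hat z^\ell$. 3. For each $\omega\in\Omega$, solve the Lagrangian dual $\max_\lambda R^\omega(\hat z^\ell_{\cdot,\tau^\omega-1},\lambda)$; let $\lambda^{\omega,\ell}$ be an optimal solution and $v^{\omega,\ell}=R^\omega(\hat z^\ell_{\cdot,\tau^\omega-1},\lambda^{\omega,\ell})$ the optimal value; add the corresponding cut to the master problem. 4. Set $\ell=\ell+1$. Upon exiting the loop, output $UB$ and $z^*$. Wherever several optimal solutions exist, any one may be chosen. *)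

theory Defs
  imports Complex_Main "HOL-Library.Extended_Real"
begin

datatype ('b, 'g) component = Bus 'b | Gen 'g | Line "'b \<times> 'b"

text \<open>
  Attachment of generators and loads to exactly one bus is encoded by the functions
  \<open>gen_bus\<close> and \<open>load_bus\<close>. Binary data and binary variables are real-valued functions with
  values in \<open>{0, 1}\<close> on the relevant index set.
\<close>

record ('b, 'g, 'd, 's) grid =
  buses :: "'b set"
  gens :: "'g set"
  loads :: "'d set"
  lines :: "('b \<times> 'b) set"
  horizon :: nat
  gen_bus :: "'g \<Rightarrow> 'b"
  load_bus :: "'d \<Rightarrow> 'b"
  demand :: "'d \<Rightarrow> nat \<Rightarrow> real"
  priority :: "'d \<Rightarrow> real"
  damage_cost :: "('b, 'g) component \<Rightarrow> real"
  gen_min :: "'g \<Rightarrow> real"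
  gen_max :: "'g \<Rightarrow> real"
  thermal :: "'b \<times> 'b \<Rightarrow> real"
  suscept :: "'b \<times> 'b \<Rightarrow> real"
  angle_lo :: real
  angle_hi :: real
  scenarios :: "'s set"
  prob :: "'s \<Rightarrow> real"
  tau :: "'s \<Rightarrow> nat"
  fault_v :: "'s \<Rightarrow> ('b, 'g) component \<Rightarrow> real"
  fault_u :: "'s \<Rightarrow> ('b, 'g) component \<Rightarrow> real"
  spread :: "'s \<Rightarrow> ('b, 'g) component \<Rightarrow> ('b, 'g) component set"

definition comps :: "('b, 'g, 'd, 's) grid \<Rightarrow> ('b, 'g) component set" where
  "comps I = Bus ` buses I \<union> Gen ` gens I \<union> Line ` lines I"

definition periods :: "('b, 'g, 'd, 's) grid \<Rightarrow> nat set" where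
  "periods I = {1..horizon I}"

definition gens_at :: "('b, 'g, 'd, 's) grid \<Rightarrow> 'b \<Rightarrow> 'g set" where
  "gens_at I i = {g \<in> gens I. gen_bus I g = i}"

definition loads_at :: "('b, 'g, 'd, 's) grid \<Rightarrow> 'b \<Rightarrow> 'd set" where
  "loads_at I i = {d \<in> loads I. load_bus I d = i}"

definition lines_into :: "('b, 'g, 'd, 's) grid \<Rightarrow> 'b \<Rightarrow> ('b \<times> 'b) set" where
  "lines_into I i = {l \<in> lines I. snd l = i}"

definition lines_out :: "('b, 'g, 'd, 's) grid \<Rightarrow> 'b \<Rightarrow> ('b \<times> 'b) set" where
  "lines_out I i = {l \<in> lines I. fst l = i}"

definition valid_grid :: "('b, 'g, 'd, 's) grid \<Rightarrow> bool" where
  "valid_grid I \<longleftrightarrow>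
     finite (buses I) \<and> finite (gens I) \<and> finite (loads I) \<and>
     finite (lines I) \<and> lines I \<subseteq> buses I \<times> buses I \<and>
     (\<forall>g \<in> gens I. gen_bus I g \<in> buses I) \<and>
     (\<forall>d \<in> loads I. load_bus I d \<in> buses I) \<and>
     (\<forall>d \<in> loads I. priority I d \<ge> 0) \<and>
     (\<forall>c \<in> comps I. damage_cost I c \<ge> 0) \<and>
     (\<forall>g \<in> gens I. gen_min I g \<le> gen_max I g) \<and>
     (\<forall>l \<in> lines I. thermal I l \<ge> 0) \<and>
     (\<forall>l \<in> lines I. suscept I l \<le> 0) \<and>
     angle_lo I \<le> 0 \<and> 0 \<le> angle_hi I \<and>
     finite (scenarios I) \<and>
     (\<forall>\<omega> \<in> scenarios I. prob I \<omega> \<ge> 0) \<and>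
     (\<Sum>\<omega> \<in> scenarios I. prob I \<omega>) = 1 \<and>
     (\<forall>\<omega> \<in> scenarios I.
        tau I \<omega> \<in> {2..horizon I + 1} \<and>
        (\<forall>c \<in> comps I. fault_u I \<omega> c \<in> {0, 1} \<and> fault_v I \<omega> c \<in> {0, 1} \<and>
           spread I \<omega> c \<subseteq> comps I) \<and>
        (tau I \<omega> = horizon I + 1 \<longrightarrow>
           (\<forall>c \<in> comps I. fault_u I \<omega> c = 0 \<and> fault_v I \<omega> c = 0)))"

text \<open>The continuous variables \<open>(\<theta>, P\<^sup>L, P\<^sup>G, x)\<close> of either stage.\<close>

record ('b, 'g, 'd) dispatch =
  theta :: "'b \<Rightarrow> nat \<Rightarrow> real"
  flow :: "'b \<times> 'b \<Rightarrow> nat \<Rightarrow> real"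
  gen :: "'g \<Rightarrow> nat \<Rightarrow> real"
  served :: "'d \<Rightarrow> nat \<Rightarrow> real"

type_synonym ('b, 'g) plan = "('b, 'g) component \<Rightarrow> nat \<Rightarrow> real"

definition operational ::
  "('b, 'g, 'd, 's) grid \<Rightarrow> nat \<Rightarrow> ('b, 'g, 'd) dispatch \<Rightarrow> (('b, 'g) component \<Rightarrow> real) \<Rightarrow> bool"
where
  "operational I t q z \<longleftrightarrow>
     (\<forall>(i, j) \<in> lines I.
        flow q (i, j) t \<le> - suscept I (i, j) *
          (theta q i t - theta q j t + angle_hi I * (1 - z (Line (i, j)))) \<and>
        flow q (i, j) t \<ge> - suscept I (i, j) *
          (theta q i t - theta q j t + angle_lo I * (1 - z (Line (i, j)))) \<and>
        - thermal I (i, j) * z (Line (i, j)) \<le> flow q (i, j) t \<and>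
        flow q (i, j) t \<le> thermal I (i, j) * z (Line (i, j))) \<and>
     (\<forall>i \<in> buses I.
        (\<Sum>g \<in> gens_at I i. gen q g t)
        + ((\<Sum>l \<in> lines_into I i. flow q l t) - (\<Sum>l \<in> lines_out I i. flow q l t))
        = (\<Sum>d \<in> loads_at I i. demand I d t * served q d t)) \<and>
     (\<forall>g \<in> gens I. gen_min I g * z (Gen g) \<le> gen q g t \<and>
        gen q g t \<le> gen_max I g * z (Gen g)) \<and>
     (\<forall>i \<in> buses I. \<forall>d \<in> loads_at I i. z (Bus i) \<ge> served q d t) \<and>
     (\<forall>d \<in> loads I. 0 \<le> served q d t \<and> served q d t \<le> 1)"

definition bus_dominates ::
  "('b, 'g, 'd, 's) grid \<Rightarrow> (('b, 'g) component \<Rightarrow> real) \<Rightarrow> bool"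
where
  "bus_dominates I z \<longleftrightarrow>
     (\<forall>i \<in> buses I. \<forall>g \<in> gens_at I i. z (Bus i) \<ge> z (Gen g)) \<and>
     (\<forall>(i, j) \<in> lines I. z (Bus i) \<ge> z (Line (i, j))) \<and>
     (\<forall>(j, i) \<in> lines I. z (Bus i) \<ge> z (Line (j, i)))"

definition shed_cost ::
  "('b, 'g, 'd, 's) grid \<Rightarrow> nat set \<Rightarrow> ('b, 'g, 'd) dispatch \<Rightarrow> real"
where
  "shed_cost I A q = (\<Sum>t \<in> A. \<Sum>d \<in> loads I. priority I d * (1 - served q d t))"

definition second_stage_feasible ::
  "('b, 'g, 'd, 's) grid \<Rightarrow> 's \<Rightarrow> ('b, 'g, 'd) dispatch \<Rightarrow> (('b, 'g) component \<Rightarrow> real) \<Rightarrow>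
   (('b, 'g) component \<Rightarrow> real) \<Rightarrow> (('b, 'g) component \<Rightarrow> real) \<Rightarrow> bool"
where
  "second_stage_feasible I \<omega> q y \<eta> z \<longleftrightarrow>
     (\<forall>c \<in> comps I. y c \<in> {0, 1} \<and> \<eta> c \<in> {0, 1} \<and> z c \<in> {0, 1}) \<and>
     (\<forall>t \<in> {tau I \<omega>..horizon I}. operational I t q y) \<and>
     bus_dominates I y \<and>
     (\<forall>c \<in> comps I. y c \<le> z c \<and> y c \<le> 1 - \<eta> c \<and> \<eta> c \<ge> fault_v I \<omega> c) \<and>
     (\<forall>c \<in> comps I. \<forall>k \<in> spread I \<omega> c. \<eta> k \<ge> fault_u I \<omega> c * z c)"

text \<open>
  The value functions \<open>f\<^sup>\<omega>\<close> and \<open>R\<^sup>\<omega>\<close> are minima, hence \<open>LEAST\<close>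
  rather than an infimum that need not be attained.
\<close>

definition recourse ::
  "('b, 'g, 'd, 's) grid \<Rightarrow> 's \<Rightarrow> (('b, 'g) component \<Rightarrow> real) \<Rightarrow> real"
where
  "recourse I \<omega> zhat =
     (LEAST r. \<exists>q y \<eta> z. second_stage_feasible I \<omega> q y \<eta> z \<and>
        (\<forall>c \<in> comps I. z c = zhat c) \<and>
        r = shed_cost I {tau I \<omega>..horizon I} q + (\<Sum>c \<in> comps I. damage_cost I c * \<eta> c))"

definition lagrangian ::
  "('b, 'g, 'd, 's) grid \<Rightarrow> 's \<Rightarrow> (('b, 'g) component \<Rightarrow> real) \<Rightarrow>
   (('b, 'g) component \<Rightarrow> real) \<Rightarrow> real"
where
  "lagrangian I \<omega> zhat lam =
     (LEAST r. \<exists>q y \<eta> z. second_stage_feasible I \<omega> q y \<eta> z \<and>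
        r = shed_cost I {tau I \<omega>..horizon I} q
            + (\<Sum>c \<in> comps I. damage_cost I c * \<eta> c + lam c * (zhat c - z c)))"

definition dual_optimal ::
  "('b, 'g, 'd, 's) grid \<Rightarrow> 's \<Rightarrow> (('b, 'g) component \<Rightarrow> real) \<Rightarrow>
   (('b, 'g) component \<Rightarrow> real) \<Rightarrow> bool"
where
  "dual_optimal I \<omega> zhat lam \<longleftrightarrow> (\<forall>lam'. lagrangian I \<omega> zhat lam' \<le> lagrangian I \<omega> zhat lam)"

definition first_stage_feasible ::
  "('b, 'g, 'd, 's) grid \<Rightarrow> ('b, 'g, 'd) dispatch \<Rightarrow> ('b, 'g) plan \<Rightarrow> bool"
where
  "first_stage_feasible I q z \<longleftrightarrow>
     (\<forall>t \<in> periods I.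
        operational I t q (\<lambda>c. z c t) \<and>
        bus_dominates I (\<lambda>c. z c t) \<and>
        (\<forall>c \<in> comps I. z c t \<ge> z c (min (t + 1) (horizon I)) \<and> z c t \<in> {0, 1}))"

definition at_disruption ::
  "('b, 'g, 'd, 's) grid \<Rightarrow> 's \<Rightarrow> ('b, 'g) plan \<Rightarrow> ('b, 'g) component \<Rightarrow> real"
where
  "at_disruption I \<omega> z = (\<lambda>c. z c (tau I \<omega> - 1))"

definition P_objective ::
  "('b, 'g, 'd, 's) grid \<Rightarrow> ('b, 'g, 'd) dispatch \<Rightarrow> ('b, 'g) plan \<Rightarrow> real"
where
  "P_objective I q z =
     (\<Sum>\<omega> \<in> scenarios I. prob I \<omega> *
        (shed_cost I {1..tau I \<omega> - 1} q + recourse I \<omega> (at_disruption I \<omega> z)))"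

definition P_optimal ::
  "('b, 'g, 'd, 's) grid \<Rightarrow> ('b, 'g, 'd) dispatch \<Rightarrow> ('b, 'g) plan \<Rightarrow> bool"
where
  "P_optimal I q z \<longleftrightarrow>
     first_stage_feasible I q z \<and>
     (\<forall>q' z'. first_stage_feasible I q' z' \<longrightarrow> P_objective I q z \<le> P_objective I q' z')"

text \<open>The cuts generated in one iteration, for all scenarios.\<close>

record ('b, 'g, 's) cut =
  cut_val :: "'s \<Rightarrow> real"
  cut_mult :: "'s \<Rightarrow> ('b, 'g) component \<Rightarrow> real"
  cut_point :: "('b, 'g) plan"

definition master_feasible ::
  "('b, 'g, 'd, 's) grid \<Rightarrow> ('b, 'g, 's) cut list \<Rightarrow>
   ('b, 'g, 'd) dispatch \<Rightarrow> ('b, 'g) plan \<Rightarrow> ('s \<Rightarrow> real) \<Rightarrow> bool"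
where
  "master_feasible I cs q z V \<longleftrightarrow>
     first_stage_feasible I q z \<and>
     (\<forall>\<omega> \<in> scenarios I. V \<omega> \<ge> 0 \<and>
        (\<forall>k \<in> set cs. V \<omega> \<ge> cut_val k \<omega> +
           (\<Sum>c \<in> comps I. cut_mult k \<omega> c *
              (at_disruption I \<omega> z c - at_disruption I \<omega> (cut_point k) c))))"

definition master_objective ::
  "('b, 'g, 'd, 's) grid \<Rightarrow> ('b, 'g, 'd) dispatch \<Rightarrow> ('s \<Rightarrow> real) \<Rightarrow> real"
where
  "master_objective I q V =
     (\<Sum>\<omega> \<in> scenarios I. prob I \<omega> * (shed_cost I {1..tau I \<omega> - 1} q + V \<omega>))"

definition master_optimal ::
  "('b, 'g, 'd, 's) grid \<Rightarrow> ('b, 'g, 's) cut list \<Rightarrow>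
   ('b, 'g, 'd) dispatch \<Rightarrow> ('b, 'g) plan \<Rightarrow> ('s \<Rightarrow> real) \<Rightarrow> bool"
where
  "master_optimal I cs q z V \<longleftrightarrow>
     master_feasible I cs q z V \<and>
     (\<forall>q' z' V'. master_feasible I cs q' z' V' \<longrightarrow>
        master_objective I q V \<le> master_objective I q' V')"

text \<open>
  The iteration counter \<open>\<ell>\<close> is \<open>length (cuts s) + 1\<close>, so it is not stored separately.
\<close>

record ('b, 'g, 's) state =
  cuts :: "('b, 'g, 's) cut list"
  LB :: real
  UB :: ereal
  incumbent :: "('b, 'g) plan option"

definition alg_init :: "('b, 'g, 's) state" where
  "alg_init = \<lparr>cuts = [], LB = 0, UB = \<infinity>, incumbent = None\<rparr>"

definition loop_guard :: "real \<Rightarrow> ('b, 'g, 's) state \<Rightarrow> bool" where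
  "loop_guard \<epsilon> s \<longleftrightarrow> UB s = \<infinity> \<or> UB s - ereal (LB s) > ereal \<epsilon> * UB s"

text \<open>
  One pass through the loop body. It is a relation because the optimal solutions of the master
  problem and of the Lagrangian duals may be chosen arbitrarily.
\<close>

definition alg_step ::
  "('b, 'g, 'd, 's) grid \<Rightarrow> real \<Rightarrow> ('b, 'g, 's) state \<Rightarrow> ('b, 'g, 's) state \<Rightarrow> bool"
where
  "alg_step I \<epsilon> s s' \<longleftrightarrow>
     loop_guard \<epsilon> s \<and>
     (\<exists>(q :: ('b, 'g, 'd) dispatch) z V lam.
        master_optimal I (cuts s) q z V \<and>
        (\<forall>\<omega> \<in> scenarios I. dual_optimal I \<omega> (at_disruption I \<omega> z) (lam \<omega>)) \<and>
        (let Zl = master_objective I q V;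
             Zbar = Zl + (\<Sum>\<omega> \<in> scenarios I. prob I \<omega> *
                            (recourse I \<omega> (at_disruption I \<omega> z) - V \<omega>));
             new = \<lparr>cut_val = (\<lambda>\<omega>. lagrangian I \<omega> (at_disruption I \<omega> z) (lam \<omega>)),
                    cut_mult = lam, cut_point = z\<rparr>
         in s' = \<lparr>cuts = cuts s @ [new],
                  LB = Zl,
                  UB = (if ereal Zbar < UB s then ereal Zbar else UB s),
                  incumbent = (if ereal Zbar < UB s then Some z else incumbent s)\<rparr>))"

end

theory Submission
  imports Defs "HOL-Analysis.Analysis"
begin

text \<open>
  For fixed binary variables each second-stage or master problem is a linear program bounded below,
  whose minimum is attained because Fourier--Motzkin elimination exhibits the set of objective values
  as a closed set; the binary variables take finitely many values, so all minima exist.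

  The Lagrangian cuts are valid by weak duality, so the master value is a lower bound. At a binary
  point the Lagrangian dual has no gap, so each cut is tight at the point that generated it. There
  are finitely many binary plans, hence in an infinite run the master problem would return a plan
  for the second time; its cut then forces \<open>V \<omega>\<close> up to the true recourse value, the lower bound
  meets the upper bound, and the loop stops.
\<close>

subsection \<open>Fourier--Motzkin elimination\<close>

text \<open>\<open>recourse\<close> and \<open>lagrangian\<close> are defined by
  \<open>LEAST\<close>, which says nothing about a set without a minimum, so attainment must precede
  every inequality about them. Compactness does not give it: the constraints see only differences of
  angles, so a common shift of all angles preserves feasibility and the feasible sets are in general
  unbounded. Elimination asks only for a lower bound on the cost, and 0 is one.

  Mixed-integer programs usually have a duality gap. Here the dualised constraint fixes a vertex of
  the unit cube, and the Hamming distance from a vertex is affine on the binary points. A multiple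
  of it is therefore an exact penalty of just the form that the Lagrangian term offers.

  Plans and binary vectors are functions on a whole type, so "finitely many" is true only after
  restriction to \<open>comps I\<close> and \<open>periods I\<close>. This is why congruence lemmas
  and restricted keys accompany the argument.\<close>

definition affine_form :: "'x set \<Rightarrow> (('x \<Rightarrow> real) \<Rightarrow> real) \<Rightarrow> bool" where
  "affine_form X F \<longleftrightarrow> (\<exists>a b. \<forall>v. F v = b + (\<Sum>x\<in>X. a x * v x))"

lemma affine_formI: "(\<And>v. F v = b + (\<Sum>x\<in>X. a x * v x)) \<Longrightarrow> affine_form X F"
  unfolding affine_form_def by auto

lemma affine_form_const: "affine_form X (\<lambda>v. k)"
  unfolding affine_form_def by (rule exI[of _ "\<lambda>_. 0"], rule exI[of _ k]) simp

lemma affine_form_coord: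
  assumes "finite X" "x \<in> X"
  shows "affine_form X (\<lambda>v. v x)"
  unfolding affine_form_def
proof (intro exI allI)
  fix v :: "'a \<Rightarrow> real"
  have "(\<Sum>y\<in>X. (if y = x then 1 else 0) * v y) = (\<Sum>y\<in>X. if y = x then v y else 0)"
    by (rule sum.cong) auto
  then show "v x = 0 + (\<Sum>y\<in>X. (if y = x then 1 else 0) * v y)"
    using assms by simp
qed

lemma affine_form_add:
  assumes "affine_form X F" "affine_form X G"
  shows "affine_form X (\<lambda>v. F v + G v)"
proof -
  obtain a b a' b' where "\<And>v. F v = b + (\<Sum>x\<in>X. a x * v x)" "\<And>v. G v = b' + (\<Sum>x\<in>X. a' x * v x)"
    using assms unfolding affine_form_def by blast
  then have "F v + G v = (b + b') + (\<Sum>x\<in>X. (a x + a' x) * v x)" for v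
    by (simp add: sum.distrib algebra_simps)
  then show ?thesis
    by (rule affine_formI)
qed

lemma affine_form_scale:
  assumes "affine_form X F"
  shows "affine_form X (\<lambda>v. k * F v)"
proof -
  obtain a b where "\<And>v. F v = b + (\<Sum>x\<in>X. a x * v x)"
    using assms unfolding affine_form_def by blast
  then have "k * F v = k * b + (\<Sum>x\<in>X. (k * a x) * v x)" for v
    by (simp add: sum_distrib_left algebra_simps)
  then show ?thesis
    by (rule affine_formI)
qed

lemma affine_form_diff:
  assumes "affine_form X F" "affine_form X G"
  shows "affine_form X (\<lambda>v. F v - G v)"
  using affine_form_add[OF assms(1) affine_form_scale[OF assms(2), of "-1"]] by simp

lemma affine_form_sum:
  assumes "\<And>i. i \<in> A \<Longrightarrow> affine_form X (F i)"
  shows "affine_form X (\<lambda>v. \<Sum>i\<in>A. F i v)"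
  using assms
  by (induction A rule: infinite_finite_induct) (auto intro: affine_form_const affine_form_add)

lemma affine_form_cong:
  assumes "affine_form X F" "\<And>x. x \<in> X \<Longrightarrow> v x = w x"
  shows "F v = F w"
proof -
  obtain a b where "\<And>v. F v = b + (\<Sum>x\<in>X. a x * v x)"
    using assms unfolding affine_form_def by blast
  then show ?thesis
    using assms(2) by simp
qed

lemmas affine_form_intros =
  affine_form_const affine_form_coord affine_form_add affine_form_diff affine_form_scale
  affine_form_sum

text \<open>Isolates the variable to be eliminated: \<open>a\<close> is its coefficient, and the
  remainder \<open>G\<close> does not read coordinate \<open>y\<close>.\<close>

lemma affine_form_split:
  assumes "affine_form (insert y X) F" "finite X" "y \<notin> X"
  obtains G a where "affine_form X G" "\<And>v t. F (v(y := t)) = G v + a * t"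
proof -
  obtain a b where F: "\<And>v. F v = b + (\<Sum>x\<in>insert y X. a x * v x)"
    using assms(1) unfolding affine_form_def by blast
  have "affine_form X (\<lambda>v. b + (\<Sum>x\<in>X. a x * v x))"
    unfolding affine_form_def by blast
  moreover have "F (v(y := t)) = (b + (\<Sum>x\<in>X. a x * v x)) + a y * t" for v t
  proof -
    have "(\<Sum>x\<in>X. a x * (v(y := t)) x) = (\<Sum>x\<in>X. a x * v x)"
      using assms(3) by (intro sum.cong) auto
    then show ?thesis
      using assms(2,3) by (simp add: F)
  qed
  ultimately show ?thesis
    using that by blast
qed

section \<open>Finite systems of affine inequalities and their projections\<close>

definition polyhedral :: "'x set \<Rightarrow> (('x \<Rightarrow> real) \<Rightarrow> bool) \<Rightarrow> bool" where
  "polyhedral X P \<longleftrightarrow>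
     (\<exists>C. finite C \<and> (\<forall>F\<in>C. affine_form X F) \<and> (\<forall>v. P v \<longleftrightarrow> (\<forall>F\<in>C. F v \<le> 0)))"

lemma polyhedral_le:
  assumes "affine_form X F" "affine_form X G"
  shows "polyhedral X (\<lambda>v. F v \<le> G v)"
  unfolding polyhedral_def
  by (rule exI[of _ "{\<lambda>v. F v - G v}"]) (auto intro: affine_form_diff assms)

lemma polyhedral_conj:
  assumes "polyhedral X P" "polyhedral X Q"
  shows "polyhedral X (\<lambda>v. P v \<and> Q v)"
proof -
  obtain C D where "finite C" "\<forall>F\<in>C. affine_form X F" "\<forall>v. P v \<longleftrightarrow> (\<forall>F\<in>C. F v \<le> 0)"
    and "finite D" "\<forall>F\<in>D. affine_form X F" "\<forall>v. Q v \<longleftrightarrow> (\<forall>F\<in>D. F v \<le> 0)"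
    using assms unfolding polyhedral_def by blast
  then show ?thesis
    unfolding polyhedral_def by (intro exI[of _ "C \<union> D"]) auto
qed

lemma polyhedral_eq:
  assumes "affine_form X F" "affine_form X G"
  shows "polyhedral X (\<lambda>v. F v = G v)"
  using polyhedral_conj[OF polyhedral_le[OF assms] polyhedral_le[OF assms(2,1)]]
  by (simp add: eq_iff)

lemma polyhedral_ball:
  assumes "finite A" "\<And>i. i \<in> A \<Longrightarrow> polyhedral X (P i)"
  shows "polyhedral X (\<lambda>v. \<forall>i\<in>A. P i v)"
  using assms
proof (induction A rule: finite_induct)
  case empty
  show ?case
    unfolding polyhedral_def by (rule exI[of _ "{}"]) simp
next
  case (insert i A)
  then show ?case
    by (simp add: polyhedral_conj)
qed

text \<open>The largest lower bound serves as \<open>t\<close>, or the smallest upper bound if there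
  is no lower one. The case split is there because \<open>Max\<close> and \<open>Min\<close> are
  unspecified on the empty set.\<close>

lemma between_finite_sets:
  fixes L U :: "'a::linorder set"
  assumes "finite L" "finite U" "\<And>l u. l \<in> L \<Longrightarrow> u \<in> U \<Longrightarrow> l \<le> u"
  shows "\<exists>t. (\<forall>l\<in>L. l \<le> t) \<and> (\<forall>u\<in>U. t \<le> u)"
proof (cases "L = {}")
  case True
  show ?thesis
  proof (cases "U = {}")
    case False
    then show ?thesis
      using True assms(2) by (intro exI[of _ "Min U"]) auto
  qed (use True in auto)
next
  case False
  then show ?thesis
    using assms by (intro exI[of _ "Max L"]) auto
qed

text \<open>One elimination step. Solved for \<open>t\<close>, each constraint is free of
  \<open>t\<close>, a lower bound or an upper bound, according to the sign of its coefficient. A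
  suitable \<open>t\<close> exists iff every lower bound is at most every upper bound, and these
  comparisons are again finitely many affine inequalities.\<close>

lemma polyhedral_project:
  assumes P: "polyhedral (insert y X) P" and X: "finite X" "y \<notin> X"
  shows "polyhedral X (\<lambda>v. \<exists>t. P (v(y := t)))"
proof -
  obtain C where C: "finite C" "\<And>F. F \<in> C \<Longrightarrow> affine_form (insert y X) F"
    and PC: "\<And>v. P v \<longleftrightarrow> (\<forall>F\<in>C. F v \<le> 0)"
    using P unfolding polyhedral_def by blast
  have "\<forall>F\<in>C. \<exists>G a. affine_form X G \<and> (\<forall>v t. F (v(y := t)) = G v + a * t)"
    using affine_form_split[OF C(2) X] by metis
  then obtain g a where g: "\<And>F. F \<in> C \<Longrightarrow> affine_form X (g F)"
    and F: "\<And>F v t. F \<in> C \<Longrightarrow> F (v(y := t)) = g F v + a F * t"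
    by metis
  define Z where "Z = {F \<in> C. a F = 0}"
  define U where "U = {F \<in> C. a F > 0}"
  define L where "L = {F \<in> C. a F < 0}"
  have fin: "finite Z" "finite U" "finite L"
    using C(1) by (auto simp: Z_def U_def L_def)
  have "(\<exists>t. P (v(y := t))) \<longleftrightarrow>
      (\<forall>F\<in>Z. g F v \<le> 0) \<and> (\<forall>E\<in>L. \<forall>F\<in>U. (- 1 / a E) * g E v \<le> (- 1 / a F) * g F v)" for v
  proof -
    have "P (v(y := t)) \<longleftrightarrow>
        (\<forall>F\<in>Z. g F v \<le> 0) \<and> (\<forall>E\<in>L. (- 1 / a E) * g E v \<le> t) \<and> (\<forall>F\<in>U. t \<le> (- 1 / a F) * g F v)" for t
    proof -
      have z: "F (v(y := t)) \<le> 0 \<longleftrightarrow> g F v \<le> 0" if "F \<in> Z" for F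
        using that by (simp add: Z_def F)
      \<comment> \<open>Division by the negative coefficient reverses the inequality, which turns
        the constraint into a lower bound.\<close>
      have l: "F (v(y := t)) \<le> 0 \<longleftrightarrow> (- 1 / a F) * g F v \<le> t" if "F \<in> L" for F
        using that by (auto simp: L_def F field_simps)
      have u: "F (v(y := t)) \<le> 0 \<longleftrightarrow> t \<le> (- 1 / a F) * g F v" if "F \<in> U" for F
        using that by (auto simp: U_def F field_simps)
      have "C = Z \<union> L \<union> U"
        by (auto simp: Z_def L_def U_def)
      then show ?thesis
        using z l u by (simp add: PC ball_Un)
    qed
    moreover have "(\<exists>t. (\<forall>E\<in>L. (- 1 / a E) * g E v \<le> t) \<and> (\<forall>F\<in>U. t \<le> (- 1 / a F) * g F v)) \<longleftrightarrow>
        (\<forall>E\<in>L. \<forall>F\<in>U. (- 1 / a E) * g E v \<le> (- 1 / a F) * g F v)" (is "?l \<longleftrightarrow> ?r")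
    proof
      assume ?l
      then show ?r
        by (meson order_trans)
    next
      assume ?r
      then have "\<exists>t. (\<forall>l\<in>(\<lambda>E. (- 1 / a E) * g E v) ` L. l \<le> t) \<and> (\<forall>u\<in>(\<lambda>F. (- 1 / a F) * g F v) ` U. t \<le> u)"
        using fin by (intro between_finite_sets) auto
      then show ?l
        by simp
    qed
    ultimately show ?thesis
      by auto
  qed
  moreover have "polyhedral X (\<lambda>v. (\<forall>F\<in>Z. g F v \<le> 0) \<and>
      (\<forall>E\<in>L. \<forall>F\<in>U. (- 1 / a E) * g E v \<le> (- 1 / a F) * g F v))"
    by (intro polyhedral_conj polyhedral_ball polyhedral_le affine_form_const affine_form_scale g fin)
      (auto simp: Z_def L_def U_def)
  ultimately show ?thesis
    by simp
qed

text \<open>A single function \<open>u\<close> supplies all eliminated coordinates. It also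
  overwrites coordinates outside \<open>Y \<union> X\<close>, which is harmless because affine forms
  do not read them; the base case consists of this remark.\<close>

lemma polyhedral_project_all:
  assumes "finite Y" "finite X" "Y \<inter> X = {}" "polyhedral (Y \<union> X) P"
  shows "polyhedral X (\<lambda>v. \<exists>u. P (\<lambda>x. if x \<in> X then v x else u x))"
  using assms(1,3,4)
proof (induction Y arbitrary: P rule: finite_induct)
  case empty
  then obtain C where C: "finite C" "\<forall>F\<in>C. affine_form X F" "\<forall>v. P v \<longleftrightarrow> (\<forall>F\<in>C. F v \<le> 0)"
    unfolding polyhedral_def by auto
  have "P (\<lambda>x. if x \<in> X then v x else u x) \<longleftrightarrow> P v" for u v
  proof -
    have "F (\<lambda>x. if x \<in> X then v x else u x) = F v" if "F \<in> C" for F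
      by (rule affine_form_cong[of X]) (use that C in auto)
    then have "(\<forall>F\<in>C. F (\<lambda>x. if x \<in> X then v x else u x) \<le> 0) \<longleftrightarrow> (\<forall>F\<in>C. F v \<le> 0)"
      by (metis (mono_tags))
    then show ?thesis
      unfolding C(3)[rule_format] .
  qed
  then have "(\<exists>u. P (\<lambda>x. if x \<in> X then v x else u x)) \<longleftrightarrow> (\<forall>F\<in>C. F v \<le> 0)" for v
    using C(3) by simp
  then show ?case
    using C(1,2) unfolding polyhedral_def by blast
next
  case (insert y Y)
  have "polyhedral (Y \<union> X) (\<lambda>v. \<exists>t. P (v(y := t)))"
    using insert assms(2) by (intro polyhedral_project) auto
  then have "polyhedral X (\<lambda>v. \<exists>u t. P ((\<lambda>x. if x \<in> X then v x else u x)(y := t)))"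
    using insert by auto
  moreover have "(\<exists>u t. P ((\<lambda>x. if x \<in> X then v x else u x)(y := t))) \<longleftrightarrow>
      (\<exists>u. P (\<lambda>x. if x \<in> X then v x else u x))" (is "?l \<longleftrightarrow> ?r") for v
  proof
    assume ?l
    then obtain u t where "P ((\<lambda>x. if x \<in> X then v x else u x)(y := t))"
      by blast
    moreover have "(\<lambda>x. if x \<in> X then v x else u x)(y := t) = (\<lambda>x. if x \<in> X then v x else (u(y := t)) x)"
      using insert.prems by auto
    ultimately show ?r
      by metis
  next
    assume ?r
    then obtain u where "P (\<lambda>x. if x \<in> X then v x else u x)"
      by blast
    moreover have "(\<lambda>x. if x \<in> X then v x else u x)(y := u y) = (\<lambda>x. if x \<in> X then v x else u x)"
      using insert.prems by auto
    ultimately show ?l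
      by metis
  qed
  ultimately show ?case
    by simp
qed

text \<open>Eliminating every coordinate except \<open>o'\<close> leaves a finite system in one real
  variable. Its solution set is closed, so being nonempty and bounded below it contains its
  infimum.\<close>

lemma polyhedral_min_coord:
  assumes P: "polyhedral (insert o' X) P" and X: "finite X" "o' \<notin> X"
    and ne: "P v\<^sub>0" and bdd: "\<And>v. P v \<Longrightarrow> B \<le> v o'"
  shows "\<exists>v. P v \<and> (\<forall>w. P w \<longrightarrow> v o' \<le> w o')"
proof -
  define S where "S = {v o' |v. P v}"
  have "polyhedral {o'} (\<lambda>v. \<exists>u. P (\<lambda>x. if x \<in> {o'} then v x else u x))"
    using polyhedral_project_all[of X "{o'}" P] P X by simp
  then obtain C where C: "finite C" "\<And>F. F \<in> C \<Longrightarrow> affine_form {o'} F"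
    and SC: "\<And>v. (\<exists>u. P (\<lambda>x. if x \<in> {o'} then v x else u x)) \<longleftrightarrow> (\<forall>F\<in>C. F v \<le> 0)"
    unfolding polyhedral_def by blast
  \<comment> \<open>A form over \<open>{o'}\<close> reads only that coordinate, so a real
    \<open>r\<close> can be tested through the constant assignment
    \<open>\<lambda>_. r\<close>.\<close>
  have S_eq: "S = (\<Inter>F\<in>C. {r. F (\<lambda>_. r) \<le> 0})"
  proof -
    have "r \<in> S \<longleftrightarrow> (\<exists>u. P (\<lambda>x. if x \<in> {o'} then r else u x))" for r
    proof
      assume "r \<in> S"
      then obtain v where "P v" "r = v o'"
        by (auto simp: S_def)
      moreover have "(\<lambda>x. if x \<in> {o'} then v o' else v x) = v"
        by auto
      ultimately show "\<exists>u. P (\<lambda>x. if x \<in> {o'} then r else u x)"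
        by metis
    next
      assume "\<exists>u. P (\<lambda>x. if x \<in> {o'} then r else u x)"
      then obtain u where "P (\<lambda>x. if x \<in> {o'} then r else u x)"
        by blast
      then show "r \<in> S"
        unfolding S_def by (intro CollectI exI[of _ "\<lambda>x. if x \<in> {o'} then r else u x"]) simp
    qed
    then show ?thesis
      using SC[of "\<lambda>_. r" for r] by auto
  qed
  have "closed {r. F (\<lambda>_. r) \<le> 0}" if F: "F \<in> C" for F
  proof -
    obtain a b where "\<And>v. F v = b + (\<Sum>x\<in>{o'}. a x * v x)"
      using C(2)[OF F] unfolding affine_form_def by blast
    then show ?thesis
      by (auto intro!: closed_Collect_le continuous_intros)
  qed
  then have "closed S"
    unfolding S_eq by auto
  moreover have "S \<noteq> {}" "bdd_below S"
    using ne bdd by (auto simp: S_def bdd_below_def)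
  ultimately have "Inf S \<in> S"
    by (intro closed_contains_Inf)
  moreover have lower: "Inf S \<le> r" if "r \<in> S" for r
    using that \<open>bdd_below S\<close> by (rule cInf_lower)
  ultimately obtain v where "P v" "v o' = Inf S"
    by (auto simp: S_def)
  moreover have "w o' \<in> S" if "P w" for w
    using that by (auto simp: S_def)
  ultimately show ?thesis
    using lower by metis
qed

subsection \<open>Attainment of the minima\<close>

text \<open>The variables of a single period. \<open>Objective\<close> is an epigraph variable:
  constrained to lie above the cost, it reduces minimising an affine function to minimising one
  coordinate.\<close>

datatype ('b, 'g, 'd) lp_var = Angle 'b | Flow "'b \<times> 'b" | Output 'g | Share 'd | Objective

definition dispatch_of :: "(('b, 'g, 'd) lp_var \<Rightarrow> real) \<Rightarrow> ('b, 'g, 'd) dispatch" where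
  "dispatch_of v = \<lparr>theta = \<lambda>i _. v (Angle i), flow = \<lambda>l _. v (Flow l),
     gen = \<lambda>g _. v (Output g), served = \<lambda>d _. v (Share d)\<rparr>"

definition period_shed :: "('b, 'g, 'd, 's) grid \<Rightarrow> nat \<Rightarrow> ('b, 'g, 'd) dispatch \<Rightarrow> real" where
  "period_shed I t q = (\<Sum>d \<in> loads I. priority I d * (1 - served q d t))"

lemma shed_cost_eq: "shed_cost I A q = (\<Sum>t\<in>A. period_shed I t q)"
  by (simp add: shed_cost_def period_shed_def)

lemma period_shed_nonneg:
  assumes "valid_grid I" "operational I t q \<zeta>"
  shows "0 \<le> period_shed I t q"
  using assms unfolding period_shed_def valid_grid_def operational_def
  by (intro sum_nonneg mult_nonneg_nonneg) auto

text \<open>The constraints of period \<open>t\<close> read a dispatch only at \<open>t\<close>.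
  This allows time-constant dispatches in the linear program and the gluing of solutions of
  different periods.\<close>

lemma operational_cong_period:
  assumes "\<And>i. theta q i t = theta q' i t" "\<And>l. flow q l t = flow q' l t"
    "\<And>g. gen q g t = gen q' g t" "\<And>d. served q d t = served q' d t"
  shows "operational I t q \<zeta> \<longleftrightarrow> operational I t q' \<zeta>"
  unfolding operational_def assms ..

lemma operational_cong:
  assumes "\<And>c. c \<in> comps I \<Longrightarrow> \<zeta> c = \<zeta>' c"
  shows "operational I t q \<zeta> \<longleftrightarrow> operational I t q \<zeta>'"
proof -
  have "\<zeta> (Line l) = \<zeta>' (Line l)" if "l \<in> lines I" for l
    using that assms by (auto simp: comps_def)
  moreover have "\<zeta> (Gen g) = \<zeta>' (Gen g)" if "g \<in> gens I" for g
    using that assms by (auto simp: comps_def)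
  moreover have "\<zeta> (Bus i) = \<zeta>' (Bus i)" if "i \<in> buses I" for i
    using that assms by (auto simp: comps_def)
  ultimately show ?thesis
    unfolding operational_def case_prod_unfold by simp
qed

lemma bus_dominates_cong:
  assumes "valid_grid I" "\<And>c. c \<in> comps I \<Longrightarrow> \<zeta> c = \<zeta>' c"
  shows "bus_dominates I \<zeta> \<longleftrightarrow> bus_dominates I \<zeta>'"
proof -
  have "\<zeta> (Line l) = \<zeta>' (Line l)" if "l \<in> lines I" for l
    using that assms(2) by (auto simp: comps_def)
  moreover have "\<zeta> (Gen g) = \<zeta>' (Gen g)" if "g \<in> gens_at I i" for g i
    using that assms(2) by (auto simp: comps_def gens_at_def)
  moreover have "\<zeta> (Bus i) = \<zeta>' (Bus i)" if "i \<in> buses I" for i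
    using that assms(2) by (auto simp: comps_def)
  moreover have "fst l \<in> buses I \<and> snd l \<in> buses I" if "l \<in> lines I" for l
    using that assms(1) by (auto simp: valid_grid_def)
  ultimately show ?thesis
    unfolding bus_dominates_def case_prod_unfold by simp
qed

text \<open>With \<open>\<zeta>\<close> fixed, the big-M terms and the switched limits are
  constants, so every constraint is affine in \<open>v\<close>.\<close>

lemma operational_polyhedral:
  fixes I :: "('b, 'g, 'd, 's) grid" and \<zeta> :: "('b, 'g) component \<Rightarrow> real"
  assumes "valid_grid I" and X: "finite X"
    "Angle ` buses I \<union> Flow ` lines I \<union> Output ` gens I \<union> Share ` loads I \<subseteq> X"
  shows "polyhedral X (\<lambda>v. operational I t (dispatch_of v) \<zeta>)"
proof -
  have fin: "finite (buses I)" "finite (gens I)" "finite (loads I)" "finite (lines I)"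
    using assms(1) unfolding valid_grid_def by auto
  have sub: "fst l \<in> buses I" "snd l \<in> buses I" if "l \<in> lines I" for l
    using assms(1) that unfolding valid_grid_def by auto
  show ?thesis
    unfolding operational_def dispatch_of_def case_prod_unfold
    unfolding dispatch.simps prod.collapse
    by (intro polyhedral_conj polyhedral_ball polyhedral_le polyhedral_eq affine_form_intros X(1) fin)
      (use X(2) fin sub in \<open>auto simp: gens_at_def loads_at_def lines_into_def lines_out_def\<close>)
qed

lemma operational_min:
  fixes I :: "('b, 'g, 'd, 's) grid"
  assumes "valid_grid I" "operational I t q\<^sub>0 \<zeta>"
  shows "\<exists>q. operational I t q \<zeta> \<and>
    (\<forall>q'. operational I t q' \<zeta> \<longrightarrow> period_shed I t q \<le> period_shed I t q')"
proof -
  define X :: "('b, 'g, 'd) lp_var set" where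
    "X = Angle ` buses I \<union> Flow ` lines I \<union> Output ` gens I \<union> Share ` loads I"
  define P :: "(('b, 'g, 'd) lp_var \<Rightarrow> real) \<Rightarrow> bool" where
    "P = (\<lambda>v. operational I t (dispatch_of v) \<zeta> \<and> period_shed I t (dispatch_of v) \<le> v Objective)"
  \<comment> \<open>Encodes the period-\<open>t\<close> slice of a dispatch as an assignment whose
    epigraph variable equals its cost. Hence no dispatch can undercut the optimal epigraph
    value.\<close>
  define vec :: "('b, 'g, 'd) dispatch \<Rightarrow> ('b, 'g, 'd) lp_var \<Rightarrow> real" where
    "vec q x = (case x of Angle i \<Rightarrow> theta q i t | Flow l \<Rightarrow> flow q l t | Output g \<Rightarrow> gen q g t
       | Share d \<Rightarrow> served q d t | Objective \<Rightarrow> period_shed I t q)" for q x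
  have X: "finite X" "Objective \<notin> X"
    using assms(1) by (auto simp: X_def valid_grid_def)
  have "polyhedral (insert Objective X) P"
    unfolding P_def
  proof (rule polyhedral_conj)
    show "polyhedral (insert Objective X) (\<lambda>v. operational I t (dispatch_of v) \<zeta>)"
      by (rule operational_polyhedral) (use assms X in \<open>auto simp: X_def\<close>)
    show "polyhedral (insert Objective X) (\<lambda>v. period_shed I t (dispatch_of v) \<le> v Objective)"
      unfolding period_shed_def dispatch_of_def dispatch.simps
      by (intro polyhedral_le affine_form_intros) (use X in \<open>auto simp: X_def\<close>)
  qed
  moreover have vec: "P (vec q)" if "operational I t q \<zeta>" for q
  proof -
    have "operational I t (dispatch_of (vec q)) \<zeta>"
      using that operational_cong_period[of "dispatch_of (vec q)" t q I \<zeta>]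
      by (simp add: dispatch_of_def vec_def)
    then show ?thesis
      by (simp add: P_def period_shed_def dispatch_of_def vec_def)
  qed
  moreover have "0 \<le> v Objective" if "P v" for v
    using that period_shed_nonneg[OF assms(1)] unfolding P_def by (meson order_trans)
  ultimately obtain v where v: "P v" "\<And>w. P w \<Longrightarrow> v Objective \<le> w Objective"
    using polyhedral_min_coord[of Objective X P _ 0] X assms(2) by metis
  show ?thesis
  proof (intro exI conjI allI impI)
    show "operational I t (dispatch_of v) \<zeta>"
      using v(1) by (simp add: P_def)
    fix q' assume "operational I t q' \<zeta>"
    from v(2)[OF vec[OF this]] v(1) show "period_shed I t (dispatch_of v) \<le> period_shed I t q'"
      by (simp add: P_def vec_def)
  qed
qed

text \<open>The constraints of different periods share no continuous variable, so one dispatch is optimal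
  in all periods at once.\<close>

lemma dispatch_min:
  fixes I :: "('b, 'g, 'd, 's) grid"
  assumes "valid_grid I" "\<And>t. t \<in> A \<Longrightarrow> operational I t q\<^sub>0 (\<zeta> t)"
  shows "\<exists>q. \<forall>t\<in>A. operational I t q (\<zeta> t) \<and>
    (\<forall>q'. operational I t q' (\<zeta> t) \<longrightarrow> period_shed I t q \<le> period_shed I t q')"
proof -
  have "\<forall>t\<in>A. \<exists>q. operational I t q (\<zeta> t) \<and>
      (\<forall>q'. operational I t q' (\<zeta> t) \<longrightarrow> period_shed I t q \<le> period_shed I t q')"
    using operational_min[OF assms(1)] assms(2) by blast
  then obtain Q where Q: "\<And>t. t \<in> A \<Longrightarrow> operational I t (Q t) (\<zeta> t)"
      "\<And>t q'. t \<in> A \<Longrightarrow> operational I t q' (\<zeta> t) \<Longrightarrow> period_shed I t (Q t) \<le> period_shed I t q'"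
    by metis
  \<comment> \<open>Diagonal gluing: in period \<open>t\<close> the dispatch copies
    \<open>Q t\<close>.\<close>
  define q :: "('b, 'g, 'd) dispatch" where
    "q = \<lparr>theta = \<lambda>i t. theta (Q t) i t, flow = \<lambda>l t. flow (Q t) l t,
       gen = \<lambda>g t. gen (Q t) g t, served = \<lambda>d t. served (Q t) d t\<rparr>"
  have "operational I t q (\<zeta> t)" if "t \<in> A" for t
    using Q(1)[OF that] operational_cong_period[of q t "Q t" I "\<zeta> t"] by (simp add: q_def)
  moreover have "period_shed I t q = period_shed I t (Q t)" for t
    by (simp add: period_shed_def q_def)
  ultimately show ?thesis
    using Q(2) by (intro exI[of _ q]) simp
qed

text \<open>A minimum in each fibre of \<open>key\<close>, followed by the best of these finitely
  many values. The key will be the tuple of binary variables, and a fibre problem is then purely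
  continuous.\<close>

lemma keyed_min:
  fixes f :: "'a \<Rightarrow> real"
  assumes "finite K" "\<And>x. P x \<Longrightarrow> key x \<in> K" "P x\<^sub>0"
    and "\<And>x. P x \<Longrightarrow> \<exists>m. P m \<and> (\<forall>x'. P x' \<longrightarrow> key x' = key x \<longrightarrow> f m \<le> f x')"
  shows "\<exists>m. P m \<and> (\<forall>x. P x \<longrightarrow> f m \<le> f x)"
proof -
  let ?K = "key ` Collect P"
  have fin: "finite ?K"
    by (rule finite_subset[OF _ assms(1)]) (use assms(2) in auto)
  have "\<forall>k\<in>?K. \<exists>m. P m \<and> (\<forall>x'. P x' \<longrightarrow> key x' = k \<longrightarrow> f m \<le> f x')"
    using assms(4) by blast
  then obtain m where m: "\<And>k. k \<in> ?K \<Longrightarrow> P (m k)"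
    "\<And>k x'. k \<in> ?K \<Longrightarrow> P x' \<Longrightarrow> key x' = k \<Longrightarrow> f (m k) \<le> f x'"
    by metis
  obtain k where k: "k \<in> ?K" "\<And>k'. k' \<in> ?K \<Longrightarrow> f (m k) \<le> f (m k')"
    using arg_min_if_finite(1,2)[OF fin, of "\<lambda>k. f (m k)"] assms(3)
    by (metis (no_types, lifting) empty_iff image_eqI linorder_not_less mem_Collect_eq)
  have "f (m k) \<le> f x" if "P x" for x
    using k(2)[of "key x"] m(2)[of "key x" x] that by fastforce
  then show ?thesis
    using m(1)[OF k(1)] by blast
qed

section \<open>The second-stage mixed-binary program\<close>

lemma finite_comps: "valid_grid I \<Longrightarrow> finite (comps I)"
  by (auto simp: valid_grid_def comps_def)

lemma spread_subset: "valid_grid I \<Longrightarrow> \<omega> \<in> scenarios I \<Longrightarrow> c \<in> comps I \<Longrightarrow> spread I \<omega> c \<subseteq> comps I"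
  by (auto simp: valid_grid_def)

lemma second_stage_feasible_cong:
  assumes "valid_grid I" "\<omega> \<in> scenarios I"
    and "\<And>c. c \<in> comps I \<Longrightarrow> y c = y' c \<and> \<eta> c = \<eta>' c \<and> z c = z' c"
  shows "second_stage_feasible I \<omega> q y \<eta> z \<longleftrightarrow> second_stage_feasible I \<omega> q y' \<eta>' z'"
proof -
  have "operational I t q y \<longleftrightarrow> operational I t q y'" for t
    by (rule operational_cong) (use assms in auto)
  moreover have "bus_dominates I y \<longleftrightarrow> bus_dominates I y'"
    by (rule bus_dominates_cong) (use assms in auto)
  moreover have "(\<forall>k\<in>spread I \<omega> c. \<eta> k \<ge> fault_u I \<omega> c * z c) \<longleftrightarrow>
      (\<forall>k\<in>spread I \<omega> c. \<eta>' k \<ge> fault_u I \<omega> c * z' c)" if "c \<in> comps I" for c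
    using assms(3) that spread_subset[OF assms(1,2) that] by (intro ball_cong) auto
  ultimately show ?thesis
    using assms(3) unfolding second_stage_feasible_def by (simp cong: ball_cong)
qed

text \<open>With every component off, the line constraints at flow 0 reduce to the signs of the
  big-M terms, which follow from \<open>angle_lo I \<le> 0 \<le> angle_hi I\<close> and nonpositive
  susceptances.\<close>

lemma operational_zero:
  assumes "valid_grid I"
  shows "operational I t (dispatch_of (\<lambda>_. 0)) (\<lambda>_. 0)"
  using assms unfolding operational_def dispatch_of_def valid_grid_def
  by (auto simp: mult_nonpos_nonneg mult_nonpos_nonpos)

text \<open>Complete recourse: declaring every component damaged (\<open>\<eta> = 1\<close>) and
  shut off (\<open>y = 0\<close>) meets all fault and spreading constraints, whatever the binary
  \<open>z\<close>.\<close>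

lemma second_stage_feasible_exists:
  fixes I :: "('b, 'g, 'd, 's) grid"
  assumes "valid_grid I" "\<omega> \<in> scenarios I" "\<forall>c\<in>comps I. z c \<in> {0, 1}"
  shows "\<exists>q :: ('b, 'g, 'd) dispatch. second_stage_feasible I \<omega> q (\<lambda>_. 0) (\<lambda>_. 1) z"
proof -
  have "fault_v I \<omega> c \<le> 1" "fault_u I \<omega> c * z c \<le> 1" if "c \<in> comps I" for c
  proof -
    have "fault_u I \<omega> c \<in> {0, 1}" "fault_v I \<omega> c \<in> {0, 1}"
      using assms(1,2) that by (auto simp: valid_grid_def)
    then show "fault_v I \<omega> c \<le> 1" "fault_u I \<omega> c * z c \<le> 1"
      using assms(3) that by auto
  qed
  moreover have "bus_dominates I (\<lambda>_. 0)"
    by (simp add: bus_dominates_def)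
  moreover have "0 \<le> z c" if "c \<in> comps I" for c
    using assms(3) that by auto
  ultimately show ?thesis
    using assms(3) operational_zero[OF assms(1)]
    by (intro exI[of _ "dispatch_of (\<lambda>_. 0)"]) (simp add: second_stage_feasible_def)
qed

text \<open>One attainment result for both value functions: singletons \<open>A c\<close> impose
  nonanticipativity, \<open>A c = UNIV\<close> drops it, and \<open>\<psi>\<close> is the cost
  charged per component, with or without multipliers.\<close>

lemma second_stage_min:
  fixes I :: "('b, 'g, 'd, 's) grid" and \<psi> :: "('b, 'g) component \<Rightarrow> real \<Rightarrow> real \<Rightarrow> real"
  assumes "valid_grid I" "\<omega> \<in> scenarios I" "\<forall>c\<in>comps I. z\<^sub>0 c \<in> {0, 1}"
    and "\<forall>c\<in>comps I. z\<^sub>0 c \<in> A c"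
  defines "F \<equiv> \<lambda>q \<eta> z. shed_cost I {tau I \<omega>..horizon I} q + (\<Sum>c \<in> comps I. \<psi> c (\<eta> c) (z c))"
  shows "\<exists>q y \<eta> z. (second_stage_feasible I \<omega> q y \<eta> z \<and> (\<forall>c\<in>comps I. z c \<in> A c)) \<and>
    (\<forall>q' y' \<eta>' z'. second_stage_feasible I \<omega> q' y' \<eta>' z' \<and> (\<forall>c\<in>comps I. z' c \<in> A c) \<longrightarrow>
       F q \<eta> z \<le> F q' \<eta>' z')"
proof -
  let ?C = "comps I"
  define K where "K = (?C \<rightarrow>\<^sub>E {0, 1::real}) \<times> (?C \<rightarrow>\<^sub>E {0, 1::real}) \<times> (?C \<rightarrow>\<^sub>E {0, 1::real})"
  define P where "P = (\<lambda>(q, y, \<eta>, z). second_stage_feasible I \<omega> q y \<eta> z \<and> (\<forall>c\<in>?C. z c \<in> A c))"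
  define f where "f = (\<lambda>(q, y :: ('b, 'g) component \<Rightarrow> real, \<eta>, z). F q \<eta> z)"
  define key where "key = (\<lambda>(q :: ('b, 'g, 'd) dispatch, y :: ('b, 'g) component \<Rightarrow> real,
    \<eta> :: ('b, 'g) component \<Rightarrow> real, z :: ('b, 'g) component \<Rightarrow> real).
    (restrict y ?C, restrict \<eta> ?C, restrict z ?C))"
  have "finite K"
    unfolding K_def using finite_comps[OF assms(1)] by (intro finite_cartesian_product finite_PiE) auto
  moreover have "key x \<in> K" if "P x" for x
    using that by (auto simp: P_def key_def K_def second_stage_feasible_def split: prod.splits)
  moreover obtain q\<^sub>0 where "P (q\<^sub>0, \<lambda>_. 0, \<lambda>_. 1, z\<^sub>0)"
    using second_stage_feasible_exists[where z = z\<^sub>0, OF assms(1-3)] assms(4)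
    unfolding P_def prod.case by blast
  moreover have "\<exists>m. P m \<and> (\<forall>x'. P x' \<longrightarrow> key x' = key x \<longrightarrow> f m \<le> f x')" if Px: "P x" for x
  proof -
    obtain q y \<eta> z where x: "x = (q, y, \<eta>, z)"
      by (cases x) auto
    have feas: "second_stage_feasible I \<omega> q y \<eta> z"
      using Px by (simp add: P_def x)
    have "operational I t q y" if "t \<in> {tau I \<omega>..horizon I}" for t
      using feas that unfolding second_stage_feasible_def by blast
    then have "\<exists>q1. \<forall>t\<in>{tau I \<omega>..horizon I}. operational I t q1 y \<and>
        (\<forall>q'. operational I t q' y \<longrightarrow> period_shed I t q1 \<le> period_shed I t q')"
      by (rule dispatch_min[OF assms(1)])
    then obtain q1 where q1: "\<And>t. t \<in> {tau I \<omega>..horizon I} \<Longrightarrow> operational I t q1 y"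
      "\<And>t q'. t \<in> {tau I \<omega>..horizon I} \<Longrightarrow> operational I t q' y \<Longrightarrow> period_shed I t q1 \<le> period_shed I t q'"
      by blast
    have "P (q1, y, \<eta>, z)"
      using Px q1(1) by (simp add: P_def x second_stage_feasible_def)
    moreover have "f (q1, y, \<eta>, z) \<le> f x'" if "P x'" "key x' = key x" for x'
    proof -
      obtain q' y' \<eta>' z' where x': "x' = (q', y', \<eta>', z')"
        by (cases x') auto
      have same: "y' c = y c \<and> \<eta>' c = \<eta> c \<and> z' c = z c" if "c \<in> ?C" for c
        using \<open>key x' = key x\<close> that
        unfolding x x' key_def prod.case prod.inject by (metis restrict_apply')
      \<comment> \<open>A competitor with the same key obeys the same linear programs, so
        \<open>q1\<close> is at least as good as \<open>q'\<close> in each period; the component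
        costs coincide.\<close>
      have "second_stage_feasible I \<omega> q' y \<eta> z"
        using \<open>P x'\<close> second_stage_feasible_cong[OF assms(1,2), of y' y \<eta>' \<eta> z' z] same
        by (simp add: P_def x')
      then have "shed_cost I {tau I \<omega>..horizon I} q1 \<le> shed_cost I {tau I \<omega>..horizon I} q'"
        unfolding shed_cost_eq by (intro sum_mono q1(2)) (auto simp: second_stage_feasible_def)
      then show ?thesis
        using same by (simp add: f_def F_def x')
    qed
    ultimately show ?thesis
      by blast
  qed
  ultimately have "\<exists>m. P m \<and> (\<forall>x. P x \<longrightarrow> f m \<le> f x)"
    by (rule keyed_min[where key = key])
  then show ?thesis
    unfolding P_def f_def split_paired_Ex split_paired_All prod.case .
qed

section \<open>The value functions as attained minima\<close>

lemma Least_attained: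
  fixes S :: "'a::linorder \<Rightarrow> bool"
  assumes "S m" "\<And>r. S r \<Longrightarrow> m \<le> r"
  shows "S (Least S)" "S r \<Longrightarrow> Least S \<le> r"
  using Least_equality[of S m] assms by auto

lemma recourse_min:
  fixes I :: "('b, 'g, 'd, 's) grid"
  assumes "valid_grid I" "\<omega> \<in> scenarios I" "\<forall>c\<in>comps I. zhat c \<in> {0, 1}"
  shows "\<exists>(q :: ('b, 'g, 'd) dispatch) y \<eta> z. second_stage_feasible I \<omega> q y \<eta> z \<and> (\<forall>c \<in> comps I. z c = zhat c) \<and>
      recourse I \<omega> zhat = shed_cost I {tau I \<omega>..horizon I} q + (\<Sum>c \<in> comps I. damage_cost I c * \<eta> c)"
      (is ?attained)
    and "\<And>q y \<eta> z. second_stage_feasible I \<omega> q y \<eta> z \<Longrightarrow> (\<forall>c \<in> comps I. z c = zhat c) \<Longrightarrow>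
      recourse I \<omega> zhat \<le> shed_cost I {tau I \<omega>..horizon I} q + (\<Sum>c \<in> comps I. damage_cost I c * \<eta> c)"
proof -
  let ?S = "\<lambda>r. \<exists>(q :: ('b, 'g, 'd) dispatch) y \<eta> z. second_stage_feasible I \<omega> q y \<eta> z \<and>
        (\<forall>c \<in> comps I. z c = zhat c) \<and>
        r = shed_cost I {tau I \<omega>..horizon I} q + (\<Sum>c \<in> comps I. damage_cost I c * \<eta> c)"
  obtain q y \<eta> z where opt: "second_stage_feasible I \<omega> q y \<eta> z" "\<forall>c\<in>comps I. z c \<in> {zhat c}"
    "\<And>q' y' \<eta>' z'. second_stage_feasible I \<omega> q' y' \<eta>' z' \<and> (\<forall>c\<in>comps I. z' c \<in> {zhat c}) \<Longrightarrow>
       shed_cost I {tau I \<omega>..horizon I} q + (\<Sum>c \<in> comps I. damage_cost I c * \<eta> c)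
       \<le> shed_cost I {tau I \<omega>..horizon I} q' + (\<Sum>c \<in> comps I. damage_cost I c * \<eta>' c)"
    using second_stage_min[OF assms, of "\<lambda>c. {zhat c}" "\<lambda>c a b. damage_cost I c * a"] by blast
  define m where "m = shed_cost I {tau I \<omega>..horizon I} q + (\<Sum>c \<in> comps I. damage_cost I c * \<eta> c)"
  have m: "?S m" "\<And>r. ?S r \<Longrightarrow> m \<le> r"
    using opt unfolding m_def by auto
  show ?attained
    using Least_attained(1)[of ?S, OF m] unfolding recourse_def .
  show "recourse I \<omega> zhat \<le> shed_cost I {tau I \<omega>..horizon I} q + (\<Sum>c \<in> comps I. damage_cost I c * \<eta> c)"
    if "second_stage_feasible I \<omega> q y \<eta> z" "\<forall>c \<in> comps I. z c = zhat c"
    for q :: "('b, 'g, 'd) dispatch" and y \<eta> z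
    unfolding recourse_def by (rule Least_attained(2)[of ?S, OF m]) (use that in blast)+
qed

lemma lagrangian_min:
  fixes I :: "('b, 'g, 'd, 's) grid"
  assumes "valid_grid I" "\<omega> \<in> scenarios I"
  shows "\<exists>(q :: ('b, 'g, 'd) dispatch) y \<eta> z. second_stage_feasible I \<omega> q y \<eta> z \<and>
      lagrangian I \<omega> zhat lam = shed_cost I {tau I \<omega>..horizon I} q
        + (\<Sum>c \<in> comps I. damage_cost I c * \<eta> c + lam c * (zhat c - z c))"
      (is ?attained)
    and "\<And>q y \<eta> z. second_stage_feasible I \<omega> q y \<eta> z \<Longrightarrow>
      lagrangian I \<omega> zhat lam \<le> shed_cost I {tau I \<omega>..horizon I} q
        + (\<Sum>c \<in> comps I. damage_cost I c * \<eta> c + lam c * (zhat c - z c))"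
proof -
  let ?S = "\<lambda>r. \<exists>(q :: ('b, 'g, 'd) dispatch) y \<eta> z. second_stage_feasible I \<omega> q y \<eta> z \<and>
        r = shed_cost I {tau I \<omega>..horizon I} q
          + (\<Sum>c \<in> comps I. damage_cost I c * \<eta> c + lam c * (zhat c - z c))"
  obtain q y \<eta> z where opt: "second_stage_feasible I \<omega> q y \<eta> z"
    "\<And>q' y' \<eta>' z'. second_stage_feasible I \<omega> q' y' \<eta>' z' \<Longrightarrow>
       shed_cost I {tau I \<omega>..horizon I} q
         + (\<Sum>c \<in> comps I. damage_cost I c * \<eta> c + lam c * (zhat c - z c))
       \<le> shed_cost I {tau I \<omega>..horizon I} q'
         + (\<Sum>c \<in> comps I. damage_cost I c * \<eta>' c + lam c * (zhat c - z' c))"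
    \<comment> \<open>Since \<open>z\<close> is free here, the zero vector only supplies a binary
      point that witnesses feasibility.\<close>
    using second_stage_min[OF assms, of "\<lambda>_. 0" "\<lambda>_. UNIV"
        "\<lambda>c a b. damage_cost I c * a + lam c * (zhat c - b)"] by auto
  define m where "m = shed_cost I {tau I \<omega>..horizon I} q
    + (\<Sum>c \<in> comps I. damage_cost I c * \<eta> c + lam c * (zhat c - z c))"
  have m: "?S m" "\<And>r. ?S r \<Longrightarrow> m \<le> r"
    using opt unfolding m_def by auto
  show ?attained
    using Least_attained(1)[of ?S, OF m] unfolding lagrangian_def .
  show "lagrangian I \<omega> zhat lam \<le> shed_cost I {tau I \<omega>..horizon I} q
        + (\<Sum>c \<in> comps I. damage_cost I c * \<eta> c + lam c * (zhat c - z c))"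
    if "second_stage_feasible I \<omega> q y \<eta> z"
    for q :: "('b, 'g, 'd) dispatch" and y \<eta> z
    unfolding lagrangian_def by (rule Least_attained(2)[of ?S, OF m]) (use that in blast)+
qed

lemma recourse_cong:
  assumes "\<And>c. c \<in> comps I \<Longrightarrow> zhat c = zhat' c"
  shows "recourse I \<omega> zhat = recourse I \<omega> zhat'"
  unfolding recourse_def using assms by (simp cong: ball_cong)

lemma second_stage_cost_nonneg:
  assumes "valid_grid I" "second_stage_feasible I \<omega> q y \<eta> z"
  shows "0 \<le> shed_cost I {tau I \<omega>..horizon I} q" "0 \<le> (\<Sum>c \<in> comps I. damage_cost I c * \<eta> c)"
proof -
  have "operational I t q y" if "t \<in> {tau I \<omega>..horizon I}" for t
    using assms(2) that unfolding second_stage_feasible_def by blast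
  then show "0 \<le> shed_cost I {tau I \<omega>..horizon I} q"
    unfolding shed_cost_eq by (intro sum_nonneg period_shed_nonneg[OF assms(1)])
  have "0 \<le> damage_cost I c" "0 \<le> \<eta> c" if "c \<in> comps I" for c
  proof -
    show "0 \<le> damage_cost I c"
      using assms(1) that unfolding valid_grid_def by blast
    have "\<eta> c \<in> {0, 1}"
      using assms(2) that unfolding second_stage_feasible_def by blast
    then show "0 \<le> \<eta> c"
      by auto
  qed
  then show "0 \<le> (\<Sum>c \<in> comps I. damage_cost I c * \<eta> c)"
    by (intro sum_nonneg mult_nonneg_nonneg)
qed

text \<open>Used twice: it lets the true recourse values satisfy \<open>V \<omega> \<ge> 0\<close>
  in the master problem, and it makes the penalty constant of the dual argument nonnegative.\<close>

lemma recourse_nonneg: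
  assumes "valid_grid I" "\<omega> \<in> scenarios I" "\<forall>c\<in>comps I. zhat c \<in> {0, 1}"
  shows "0 \<le> recourse I \<omega> zhat"
proof -
  obtain q y \<eta> z where "second_stage_feasible I \<omega> q y \<eta> z"
    "recourse I \<omega> zhat = shed_cost I {tau I \<omega>..horizon I} q + (\<Sum>c \<in> comps I. damage_cost I c * \<eta> c)"
    using recourse_min(1)[OF assms] by blast
  then show ?thesis
    using second_stage_cost_nonneg[OF assms(1)] by simp
qed

subsection \<open>Lagrangian cuts\<close>

text \<open>Weak duality at an arbitrary binary \<open>z\<close>, not only at \<open>zhat\<close>:
  an optimal solution for \<open>z\<close> is feasible in the relaxation at \<open>zhat\<close>,
  where it pays the multiplier term. Rearranged, this is validity of the cut at every plan.\<close>

lemma lagrangian_le_recourse: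
  assumes "valid_grid I" "\<omega> \<in> scenarios I" "\<forall>c\<in>comps I. z c \<in> {0, 1}"
  shows "lagrangian I \<omega> zhat lam \<le> recourse I \<omega> z + (\<Sum>c\<in>comps I. lam c * (zhat c - z c))"
proof -
  obtain q y \<eta> z' where 1: "second_stage_feasible I \<omega> q y \<eta> z'" "\<forall>c\<in>comps I. z' c = z c"
    "recourse I \<omega> z = shed_cost I {tau I \<omega>..horizon I} q + (\<Sum>c \<in> comps I. damage_cost I c * \<eta> c)"
    using recourse_min(1)[OF assms] by blast
  have "(\<Sum>c\<in>comps I. lam c * (zhat c - z' c)) = (\<Sum>c\<in>comps I. lam c * (zhat c - z c))"
    using 1(2) by (intro sum.cong) auto
  then show ?thesis
    using lagrangian_min(2)[OF assms(1,2) 1(1), of zhat lam] 1(3) by (simp add: sum.distrib)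
qed

text \<open>At a binary point the Lagrangian dual has no gap: flipping any coordinate of \<open>zhat\<close> can be
  charged at least \<open>recourse I \<omega> zhat\<close>, and all other costs are nonnegative.\<close>

lemma lagrangian_no_gap:
  assumes "valid_grid I" "\<omega> \<in> scenarios I" "\<forall>c\<in>comps I. zhat c \<in> {0, 1}"
  shows "recourse I \<omega> zhat \<le> lagrangian I \<omega> zhat (\<lambda>c. recourse I \<omega> zhat * (2 * zhat c - 1))"
proof -
  define K where "K = recourse I \<omega> zhat"
  have K: "0 \<le> K"
    using recourse_nonneg[OF assms] by (simp add: K_def)
  obtain q y \<eta> z where feas: "second_stage_feasible I \<omega> q y \<eta> z"
    and val: "lagrangian I \<omega> zhat (\<lambda>c. K * (2 * zhat c - 1)) = shed_cost I {tau I \<omega>..horizon I} q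
        + (\<Sum>c \<in> comps I. damage_cost I c * \<eta> c + K * (2 * zhat c - 1) * (zhat c - z c))"
    using lagrangian_min(1)[OF assms(1,2)] by blast
  \<comment> \<open>The factor \<open>2 * zhat c - 1\<close> is 1 or -1, namely the sign of
    \<open>zhat c - z c\<close> whenever two binary values differ. Each mismatch therefore costs
    exactly \<open>K\<close>.\<close>
  have pen: "K * (2 * zhat c - 1) * (zhat c - z c) = (if z c = zhat c then 0 else K)"
    if "c \<in> comps I" for c
  proof -
    have "z c \<in> {0, 1}" "zhat c \<in> {0, 1}"
      using feas assms(3) that by (auto simp: second_stage_feasible_def)
    then show ?thesis
      by auto
  qed
  let ?D = "\<Sum>c\<in>comps I. damage_cost I c * \<eta> c" and ?P = "\<Sum>c\<in>comps I. if z c = zhat c then 0 else K"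
  have val': "lagrangian I \<omega> zhat (\<lambda>c. K * (2 * zhat c - 1)) = shed_cost I {tau I \<omega>..horizon I} q + ?D + ?P"
    using val pen by (simp add: sum.distrib cong: sum.cong)
  have "K \<le> shed_cost I {tau I \<omega>..horizon I} q + ?D + ?P"
  proof (cases "\<forall>c\<in>comps I. z c = zhat c")
    case True
    then have "K \<le> shed_cost I {tau I \<omega>..horizon I} q + ?D" "0 \<le> ?P"
      using recourse_min(2)[OF assms feas] K by (auto simp: K_def intro!: sum_nonneg)
    then show ?thesis
      by linarith
  next
    case False
    then obtain c where c: "c \<in> comps I" "z c \<noteq> zhat c"
      by blast
    then have "K \<le> ?P"
      using member_le_sum[of c "comps I" "\<lambda>c. if z c = zhat c then 0 else K"] K finite_comps[OF assms(1)]
      by auto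
    then show ?thesis
      using second_stage_cost_nonneg[OF assms(1) feas] by linarith
  qed
  then show ?thesis
    using val' by (simp add: K_def)
qed

lemma lagrangian_le_recourse_self:
  assumes "valid_grid I" "\<omega> \<in> scenarios I" "\<forall>c\<in>comps I. zhat c \<in> {0, 1}"
  shows "lagrangian I \<omega> zhat lam \<le> recourse I \<omega> zhat"
  using lagrangian_le_recourse[OF assms, of zhat lam] by simp

text \<open>The multipliers range over an unbounded space, but the penalty multiplier reaches the
  upper bound given by weak duality.\<close>

lemma dual_optimal_exists:
  assumes "valid_grid I" "\<omega> \<in> scenarios I" "\<forall>c\<in>comps I. zhat c \<in> {0, 1}"
  shows "\<exists>lam. dual_optimal I \<omega> zhat lam"
  unfolding dual_optimal_def
  using order_trans[OF lagrangian_le_recourse_self[OF assms] lagrangian_no_gap[OF assms]] by blast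

text \<open>Every optimal multiplier, not just the constructed one, has the recourse value; the
  algorithm's free choice among dual optima therefore does no harm.\<close>

lemma dual_optimal_value:
  assumes "valid_grid I" "\<omega> \<in> scenarios I" "\<forall>c\<in>comps I. zhat c \<in> {0, 1}"
    and "dual_optimal I \<omega> zhat lam"
  shows "lagrangian I \<omega> zhat lam = recourse I \<omega> zhat"
proof (rule order_antisym)
  show "lagrangian I \<omega> zhat lam \<le> recourse I \<omega> zhat"
    by (rule lagrangian_le_recourse_self[OF assms(1-3)])
  show "recourse I \<omega> zhat \<le> lagrangian I \<omega> zhat lam"
    using lagrangian_no_gap[OF assms(1-3)] assms(4) unfolding dual_optimal_def by (blast intro: order_trans)
qed

section \<open>Cuts as functions of the plan\<close>

lemma tau_period: "valid_grid I \<Longrightarrow> \<omega> \<in> scenarios I \<Longrightarrow> tau I \<omega> - 1 \<in> periods I"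
  \<comment> \<open>\<open>tau I \<omega> \<ge> 2\<close> keeps the index at least 1, and
    \<open>tau I \<omega> \<le> horizon I + 1\<close> keeps it within the horizon.\<close>
  by (force simp: valid_grid_def periods_def)

lemma at_disruption_binary:
  assumes "valid_grid I" "\<omega> \<in> scenarios I" "first_stage_feasible I q z"
  shows "\<forall>c\<in>comps I. at_disruption I \<omega> z c \<in> {0, 1}"
  using tau_period[OF assms(1,2)] assms(3)
  unfolding at_disruption_def first_stage_feasible_def by blast

definition cut_bound :: "('b, 'g, 'd, 's) grid \<Rightarrow> ('b, 'g, 's) cut \<Rightarrow> 's \<Rightarrow> ('b, 'g) plan \<Rightarrow> real" where
  "cut_bound I k \<omega> z = cut_val k \<omega> + (\<Sum>c \<in> comps I. cut_mult k \<omega> c *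
     (at_disruption I \<omega> z c - at_disruption I \<omega> (cut_point k) c))"

definition valid_cut :: "('b, 'g, 'd, 's) grid \<Rightarrow> ('b, 'g, 's) cut \<Rightarrow> bool" where
  "valid_cut I k \<longleftrightarrow> (\<forall>\<omega>\<in>scenarios I. \<forall>(q :: ('b, 'g, 'd) dispatch) z. first_stage_feasible I q z \<longrightarrow>
     cut_bound I k \<omega> z \<le> recourse I \<omega> (at_disruption I \<omega> z))"

lemma valid_cut_lagrangian:
  assumes "valid_grid I"
  shows "valid_cut I \<lparr>cut_val = (\<lambda>\<omega>. lagrangian I \<omega> (at_disruption I \<omega> z) (lam \<omega>)),
    cut_mult = lam, cut_point = z\<rparr>"
proof -
  have "lagrangian I \<omega> (at_disruption I \<omega> z) (lam \<omega>) +
      (\<Sum>c\<in>comps I. lam \<omega> c * (at_disruption I \<omega> z' c - at_disruption I \<omega> z c))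
      \<le> recourse I \<omega> (at_disruption I \<omega> z')"
    if "\<omega> \<in> scenarios I" "first_stage_feasible I q z'" for \<omega> q z'
    using lagrangian_le_recourse[OF assms that(1) at_disruption_binary[OF assms that],
        of "at_disruption I \<omega> z" "lam \<omega>"]
    by (simp add: algebra_simps sum_subtractf)
  then show ?thesis
    by (simp add: valid_cut_def cut_bound_def)
qed

text \<open>At a point that agrees with the generating one the slope term vanishes, leaving the dual
  value. Agreement is asked for on \<open>comps I\<close> only, because that is all a repeated key
  provides.\<close>

lemma cut_bound_tight:
  assumes "valid_grid I" "\<omega> \<in> scenarios I" "first_stage_feasible I q z"
    and "dual_optimal I \<omega> (at_disruption I \<omega> z) (lam \<omega>)"
    and "\<And>c. c \<in> comps I \<Longrightarrow> at_disruption I \<omega> z' c = at_disruption I \<omega> z c"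
  shows "cut_bound I \<lparr>cut_val = (\<lambda>\<omega>. lagrangian I \<omega> (at_disruption I \<omega> z) (lam \<omega>)),
    cut_mult = lam, cut_point = z\<rparr> \<omega> z' = recourse I \<omega> (at_disruption I \<omega> z')"
  using dual_optimal_value[OF assms(1,2) at_disruption_binary[OF assms(1-3)] assms(4)] assms(5)
    recourse_cong[of I "at_disruption I \<omega> z'" "at_disruption I \<omega> z" \<omega>]
  by (simp add: cut_bound_def)

subsection \<open>The algorithm\<close>

lemma master_feasible_alt:
  "master_feasible I cs q z V \<longleftrightarrow> first_stage_feasible I q z \<and>
     (\<forall>\<omega> \<in> scenarios I. V \<omega> \<ge> 0 \<and> (\<forall>k \<in> set cs. V \<omega> \<ge> cut_bound I k \<omega> z))"
  by (simp add: master_feasible_def cut_bound_def)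

lemma first_stage_feasible_zero:
  assumes "valid_grid I"
  shows "first_stage_feasible I (dispatch_of (\<lambda>_. 0)) (\<lambda>_ _. 0)"
  using operational_zero[OF assms] by (auto simp: first_stage_feasible_def bus_dominates_def)

text \<open>Plans that differ only outside the grid or the horizon are identified;
  \<open>restrict\<close> fixes the values there, so the keys lie in a finite function
  space.\<close>

definition plan_key :: "('b, 'g, 'd, 's) grid \<Rightarrow> ('b, 'g) plan \<Rightarrow> ('b, 'g) component \<times> nat \<Rightarrow> real" where
  "plan_key I z = restrict (\<lambda>(c, t). z c t) (comps I \<times> periods I)"

lemma finite_plan_keys:
  assumes "valid_grid I"
  shows "finite ((comps I \<times> periods I) \<rightarrow>\<^sub>E {0, 1 :: real})"
  using finite_comps[OF assms] by (intro finite_PiE) (auto simp: periods_def)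

lemma plan_key_mem:
  assumes "first_stage_feasible I q z"
  shows "plan_key I z \<in> (comps I \<times> periods I) \<rightarrow>\<^sub>E {0, 1}"
  unfolding plan_key_def using assms by (auto simp: first_stage_feasible_def)

lemma plan_key_eqD:
  assumes "plan_key I z = plan_key I z'" "c \<in> comps I" "t \<in> periods I"
  shows "z c t = z' c t"
  using fun_cong[OF assms(1), of "(c, t)"] assms(2,3) by (simp add: plan_key_def)

lemma plan_key_at_disruption:
  assumes "valid_grid I" "\<omega> \<in> scenarios I" "plan_key I z = plan_key I z'" "c \<in> comps I"
  shows "at_disruption I \<omega> z c = at_disruption I \<omega> z' c"
  unfolding at_disruption_def using plan_key_eqD[OF assms(3,4) tau_period[OF assms(1,2)]] .

text \<open>For a fixed key the problem decouples: cuts involve only the plan, so \<open>V\<close>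
  can be taken as small as they permit, independently of the periodwise optimal dispatch.\<close>

lemma master_optimal_exists:
  fixes I :: "('b, 'g, 'd, 's) grid"
  assumes "valid_grid I"
  shows "\<exists>(q :: ('b, 'g, 'd) dispatch) z V. master_optimal I cs q z V"
proof -
  define P where "P = (\<lambda>(q :: ('b, 'g, 'd) dispatch, z, V). master_feasible I cs q z V)"
  define f where "f = (\<lambda>(q :: ('b, 'g, 'd) dispatch, z :: ('b, 'g) plan, V). master_objective I q V)"
  define key where "key = (\<lambda>(q :: ('b, 'g, 'd) dispatch, z, V :: 's \<Rightarrow> real). plan_key I z)"
  \<comment> \<open>The least admissible \<open>V\<close>. The inserted 0 is the sign constraint and
    also keeps \<open>Max\<close> defined when there are no cuts.\<close>
  define W where "W = (\<lambda>z \<omega>. Max (insert 0 ((\<lambda>k. cut_bound I k \<omega> z) ` set cs)))"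
  have W: "master_feasible I cs q z (W z)" if "first_stage_feasible I q z" for q z
    using that by (simp add: master_feasible_alt W_def)
  have fibre_min: "\<exists>m. P m \<and> (\<forall>x'. P x' \<longrightarrow> key x' = key x \<longrightarrow> f m \<le> f x')" if "P x" for x
  proof -
    obtain q z V where x: "x = (q, z, V)"
      by (cases x) auto
    have fsf: "first_stage_feasible I q z"
      using that by (simp add: P_def x master_feasible_def)
    have "operational I t q (\<lambda>c. z c t)" if "t \<in> periods I" for t
      using fsf that unfolding first_stage_feasible_def by blast
    then have "\<exists>q1. \<forall>t\<in>periods I. operational I t q1 (\<lambda>c. z c t) \<and>
        (\<forall>q'. operational I t q' (\<lambda>c. z c t) \<longrightarrow> period_shed I t q1 \<le> period_shed I t q')"
      by (rule dispatch_min[OF assms(1)])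
    then obtain q1 where q1: "\<And>t. t \<in> periods I \<Longrightarrow> operational I t q1 (\<lambda>c. z c t)"
      "\<And>t q'. t \<in> periods I \<Longrightarrow> operational I t q' (\<lambda>c. z c t) \<Longrightarrow> period_shed I t q1 \<le> period_shed I t q'"
      by blast
    have "first_stage_feasible I q1 z"
      using fsf q1(1) by (simp add: first_stage_feasible_def)
    then have "P (q1, z, W z)"
      using W by (simp add: P_def)
    moreover have "f (q1, z, W z) \<le> f x'" if "P x'" "key x' = key x" for x'
    proof -
      obtain q' z' V' where x': "x' = (q', z', V')"
        by (cases x') auto
      have feas: "master_feasible I cs q' z' V'" and keys: "plan_key I z' = plan_key I z"
        using that by (auto simp: P_def key_def x x')
      have "operational I t q' (\<lambda>c. z c t)" if "t \<in> periods I" for t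
        using operational_cong[of I "\<lambda>c. z' c t" "\<lambda>c. z c t" t q'] feas that
          plan_key_eqD[OF keys]
        by (auto simp: master_feasible_def first_stage_feasible_def)
      then have shed: "period_shed I t q1 \<le> period_shed I t q'" if "t \<in> periods I" for t
        using q1(2) that by blast
      have "prob I \<omega> * (shed_cost I {1..tau I \<omega> - 1} q1 + W z \<omega>)
          \<le> prob I \<omega> * (shed_cost I {1..tau I \<omega> - 1} q' + V' \<omega>)" if "\<omega> \<in> scenarios I" for \<omega>
      proof -
        have "{1..tau I \<omega> - 1} \<subseteq> periods I"
          using tau_period[OF assms that] by (auto simp: periods_def)
        then have "shed_cost I {1..tau I \<omega> - 1} q1 \<le> shed_cost I {1..tau I \<omega> - 1} q'"
          unfolding shed_cost_eq by (intro sum_mono shed) auto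
        moreover have "cut_bound I k \<omega> z = cut_bound I k \<omega> z'" for k
          unfolding cut_bound_def
          using plan_key_at_disruption[OF assms \<open>\<omega> \<in> scenarios I\<close> keys] by simp
        then have "W z \<omega> \<le> V' \<omega>"
          using feas that by (simp add: W_def master_feasible_alt)
        moreover have "0 \<le> prob I \<omega>"
          using assms that by (simp add: valid_grid_def)
        ultimately show ?thesis
          by (intro mult_left_mono add_mono)
      qed
      then show ?thesis
        by (simp add: f_def x' master_objective_def sum_mono)
    qed
    ultimately show ?thesis
      by blast
  qed
  have zero: "P (dispatch_of (\<lambda>_. 0), \<lambda>_ _. 0, W (\<lambda>_ _. 0))"
    using W[OF first_stage_feasible_zero[OF assms]] by (simp add: P_def)
  have keys: "key x \<in> (comps I \<times> periods I) \<rightarrow>\<^sub>E {0, 1}" if "P x" for x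
    using that plan_key_mem by (fastforce simp: P_def key_def master_feasible_def split: prod.splits)
  have "\<exists>m. P m \<and> (\<forall>x. P x \<longrightarrow> f m \<le> f x)"
    by (rule keyed_min[where key = key, OF finite_plan_keys[OF assms] keys zero fibre_min])
  then show ?thesis
    unfolding P_def f_def split_paired_Ex split_paired_All prod.case master_optimal_def .
qed

text \<open>With \<open>V\<close> set to the true recourse values, any feasible pair of (P) becomes
  master feasible at the same cost.\<close>

lemma master_value_le:
  assumes "valid_grid I" "master_optimal I cs q z V" "\<And>k. k \<in> set cs \<Longrightarrow> valid_cut I k"
    and "first_stage_feasible I q' z'"
  shows "master_objective I q V \<le> P_objective I q' z'"
proof -
  have "master_feasible I cs q' z' (\<lambda>\<omega>. recourse I \<omega> (at_disruption I \<omega> z'))"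
    using assms(3,4) recourse_nonneg[OF assms(1) _ at_disruption_binary[OF assms(1) _ assms(4)]]
    unfolding master_feasible_alt valid_cut_def by blast
  then show ?thesis
    using assms(2) unfolding master_optimal_def by (fastforce simp: master_objective_def P_objective_def)
qed

section \<open>One iteration and its invariant\<close>

lemma alg_stepE:
  fixes I :: "('b, 'g, 'd, 's) grid"
  assumes "alg_step I 0 s s'"
  obtains q :: "('b, 'g, 'd) dispatch" and z V lam where "master_optimal I (cuts s) q z V"
    "\<And>\<omega>. \<omega> \<in> scenarios I \<Longrightarrow> dual_optimal I \<omega> (at_disruption I \<omega> z) (lam \<omega>)"
    "cuts s' = cuts s @ [\<lparr>cut_val = (\<lambda>\<omega>. lagrangian I \<omega> (at_disruption I \<omega> z) (lam \<omega>)),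
                    cut_mult = lam, cut_point = z\<rparr>]"
    "LB s' = master_objective I q V"
    "UB s' = min (UB s) (ereal (P_objective I q z))"
    "incumbent s' = (if ereal (P_objective I q z) < UB s then Some z else incumbent s)"
proof -
  \<comment> \<open>The correction term replaces \<open>V \<omega>\<close> by the recourse value, so
    the candidate upper bound is the true cost of the master solution in (P).\<close>
  have P_obj: "master_objective I q V + (\<Sum>\<omega> \<in> scenarios I. prob I \<omega> *
      (recourse I \<omega> (at_disruption I \<omega> z) - V \<omega>)) = P_objective I q z" for q :: "('b, 'g, 'd) dispatch" and z V
    unfolding master_objective_def P_objective_def sum.distrib[symmetric]
    by (intro sum.cong) (auto simp: algebra_simps)
  obtain q :: "('b, 'g, 'd) dispatch" and z V lam where step: "master_optimal I (cuts s) q z V"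
    "\<And>\<omega>. \<omega> \<in> scenarios I \<Longrightarrow> dual_optimal I \<omega> (at_disruption I \<omega> z) (lam \<omega>)"
    "s' = \<lparr>cuts = cuts s @ [\<lparr>cut_val = (\<lambda>\<omega>. lagrangian I \<omega> (at_disruption I \<omega> z) (lam \<omega>)),
        cut_mult = lam, cut_point = z\<rparr>],
      LB = master_objective I q V,
      UB = (if ereal (P_objective I q z) < UB s then ereal (P_objective I q z) else UB s),
      incumbent = (if ereal (P_objective I q z) < UB s then Some z else incumbent s)\<rparr>"
    using assms unfolding alg_step_def Let_def P_obj by blast
  show ?thesis
    by (rule that[OF step(1,2)]) (auto simp: step(3) min_def)
qed

text \<open>The algorithm stores a plan without its dispatch, so a dispatch realising
  \<open>UB\<close> is carried existentially. The disjuncts \<open>UB s = \<infinity>\<close> cover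
  the initial state, which has no incumbent.\<close>

definition alg_invariant :: "('b, 'g, 'd, 's) grid \<Rightarrow> ('b, 'g, 's) state \<Rightarrow> bool" where
  "alg_invariant I s \<longleftrightarrow> (\<forall>k\<in>set (cuts s). valid_cut I k) \<and>
     (UB s = \<infinity> \<or> (\<exists>(q :: ('b, 'g, 'd) dispatch) z. incumbent s = Some z \<and> first_stage_feasible I q z \<and>
        UB s = ereal (P_objective I q z))) \<and>
     (UB s = \<infinity> \<or> (\<forall>(q :: ('b, 'g, 'd) dispatch) z. first_stage_feasible I q z \<longrightarrow> LB s \<le> P_objective I q z))"

lemma alg_invariant_step:
  fixes I :: "('b, 'g, 'd, 's) grid"
  assumes "valid_grid I" "alg_invariant I s" "alg_step I 0 s s'"
  shows "alg_invariant I s'"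
proof -
  obtain q :: "('b, 'g, 'd) dispatch" and z V lam where step: "master_optimal I (cuts s) q z V"
    "cuts s' = cuts s @ [\<lparr>cut_val = (\<lambda>\<omega>. lagrangian I \<omega> (at_disruption I \<omega> z) (lam \<omega>)),
                    cut_mult = lam, cut_point = z\<rparr>]"
    "LB s' = master_objective I q V"
    "UB s' = min (UB s) (ereal (P_objective I q z))"
    "incumbent s' = (if ereal (P_objective I q z) < UB s then Some z else incumbent s)"
    using assms(3) by (rule alg_stepE)
  have feas: "first_stage_feasible I q z"
    using step(1) by (simp add: master_optimal_def master_feasible_def)
  have cuts: "\<And>k. k \<in> set (cuts s) \<Longrightarrow> valid_cut I k"
    using assms(2) by (simp add: alg_invariant_def)
  have "\<forall>k\<in>set (cuts s'). valid_cut I k"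
    using cuts valid_cut_lagrangian[OF assms(1)] by (auto simp: step(2))
  moreover have "\<exists>(q :: ('b, 'g, 'd) dispatch) z. incumbent s' = Some z \<and> first_stage_feasible I q z \<and>
        UB s' = ereal (P_objective I q z)"
  proof (cases "ereal (P_objective I q z) < UB s")
    case True
    then show ?thesis
      using feas by (auto simp: step(4,5) min_def)
  next
    case False
    \<comment> \<open>A real candidate lies below \<infinity>, so a failure to improve means that an
      earlier incumbent exists; it is kept.\<close>
    then have "UB s \<noteq> \<infinity>"
      by auto
    then show ?thesis
      using False assms(2) by (auto simp: alg_invariant_def step(4,5) min_def)
  qed
  moreover have "LB s' \<le> P_objective I q' z'" if "first_stage_feasible I q' z'"
    for q' :: "('b, 'g, 'd) dispatch" and z'
    using master_value_le[OF assms(1) step(1) cuts that] by (simp add: step(3))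
  ultimately show ?thesis
    by (auto simp: alg_invariant_def)
qed

lemma alg_invariant_reachable:
  assumes "valid_grid I" "(alg_step I 0)\<^sup>*\<^sup>* alg_init s"
  shows "alg_invariant I s"
  using assms(2)
proof (induction rule: rtranclp_induct)
  case base
  show ?case
    by (simp add: alg_invariant_def alg_init_def)
next
  case (step s s')
  then show ?case
    using alg_invariant_step[OF assms(1)] by blast
qed

section \<open>Progress, optimality at exit and termination\<close>

lemma alg_progress:
  fixes I :: "('b, 'g, 'd, 's) grid"
  assumes "valid_grid I" "loop_guard 0 s"
  shows "\<exists>s'. alg_step I 0 s s'"
proof -
  obtain q :: "('b, 'g, 'd) dispatch" and z V where m: "master_optimal I (cuts s) q z V"
    using master_optimal_exists[OF assms(1)] by blast
  then have "first_stage_feasible I q z"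
    by (simp add: master_optimal_def master_feasible_def)
  then have "\<forall>\<omega>\<in>scenarios I. \<exists>lam. dual_optimal I \<omega> (at_disruption I \<omega> z) lam"
    using dual_optimal_exists[OF assms(1)] at_disruption_binary[OF assms(1)] by blast
  then obtain lam where "\<forall>\<omega>\<in>scenarios I. dual_optimal I \<omega> (at_disruption I \<omega> z) (lam \<omega>)"
    by metis
  then show ?thesis
    using m assms(2) unfolding alg_step_def Let_def by blast
qed

text \<open>At tolerance 0 the threshold \<open>0 * UB s\<close> vanishes, so only the sign of the
  gap matters.\<close>

lemma not_loop_guard_iff:
  assumes "UB s = ereal u"
  shows "\<not> loop_guard 0 s \<longleftrightarrow> u \<le> LB s"
  using assms by (auto simp: loop_guard_def zero_ereal_def[symmetric])

lemma alg_exit_optimal: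
  assumes "alg_invariant I s" "\<not> loop_guard 0 s"
  shows "\<exists>z q. incumbent s = Some z \<and> P_optimal I q z"
proof -
  have "UB s \<noteq> \<infinity>"
    using assms(2) by (auto simp: loop_guard_def)
  then obtain q z where qz: "incumbent s = Some z" "first_stage_feasible I q z"
      "UB s = ereal (P_objective I q z)"
    and "\<And>q' z'. first_stage_feasible I q' z' \<Longrightarrow> LB s \<le> P_objective I q' z'"
    using assms(1) unfolding alg_invariant_def by blast
  moreover have "P_objective I q z \<le> LB s"
    using not_loop_guard_iff[OF qz(3)] assms(2) by simp
  ultimately show ?thesis
    unfolding P_optimal_def by (meson order_trans)
qed

lemma alg_terminates:
  fixes I :: "('b, 'g, 'd, 's) grid"
  assumes "valid_grid I" "S 0 = alg_init" "\<And>k. alg_step I 0 (S k) (S (Suc k))"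
  shows False
proof -
  \<comment> \<open>Bundles the data of one iteration into a single relation, so that one choice
    yields the sequences \<open>q\<close>, \<open>z\<close>, \<open>V\<close>, \<open>lam\<close>
    for the whole run.\<close>
  define R where "R k q z V lam \<longleftrightarrow> master_optimal I (cuts (S k)) q z V \<and>
    (\<forall>\<omega>\<in>scenarios I. dual_optimal I \<omega> (at_disruption I \<omega> z) (lam \<omega>)) \<and>
    cuts (S (Suc k)) = cuts (S k) @ [\<lparr>cut_val = (\<lambda>\<omega>. lagrangian I \<omega> (at_disruption I \<omega> z) (lam \<omega>)),
                    cut_mult = lam, cut_point = z\<rparr>] \<and>
    LB (S (Suc k)) = master_objective I q V \<and>
    UB (S (Suc k)) = min (UB (S k)) (ereal (P_objective I q z))"
    for k and q :: "('b, 'g, 'd) dispatch" and z V lam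
  have "\<exists>q z V lam. R k q z V lam" for k
    unfolding R_def by (rule alg_stepE[OF assms(3)]) blast
  then obtain q z V lam where R: "\<And>k. R k (q k) (z k) (V k) (lam k)"
    by metis
  have step: "\<And>k. master_optimal I (cuts (S k)) (q k) (z k) (V k)"
    "\<And>k \<omega>. \<omega> \<in> scenarios I \<Longrightarrow> dual_optimal I \<omega> (at_disruption I \<omega> (z k)) (lam k \<omega>)"
    "\<And>k. cuts (S (Suc k)) = cuts (S k) @
      [\<lparr>cut_val = (\<lambda>\<omega>. lagrangian I \<omega> (at_disruption I \<omega> (z k)) (lam k \<omega>)),
        cut_mult = lam k, cut_point = z k\<rparr>]"
    "\<And>k. LB (S (Suc k)) = master_objective I (q k) (V k)"
    "\<And>k. UB (S (Suc k)) = min (UB (S k)) (ereal (P_objective I (q k) (z k)))"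
    using R unfolding R_def by blast+
  have feas: "first_stage_feasible I (q k) (z k)" for k
    using step(1)[of k] by (simp add: master_optimal_def master_feasible_def)
  have "range (\<lambda>k. plan_key I (z k)) \<subseteq> (comps I \<times> periods I) \<rightarrow>\<^sub>E {0, 1}"
    using plan_key_mem[OF feas] by blast
  then have "\<not> inj (\<lambda>k. plan_key I (z k))"
    using finite_plan_keys[OF assms(1)] by (meson finite_imageD finite_subset infinite_UNIV_nat)
  then obtain i j where ij: "i < j" "plan_key I (z j) = plan_key I (z i)"
    by (metis injI linorder_neqE_nat)
  define k where "k = \<lparr>cut_val = (\<lambda>\<omega>. lagrangian I \<omega> (at_disruption I \<omega> (z i)) (lam i \<omega>)),
        cut_mult = lam i, cut_point = z i\<rparr>"
  have mono: "set (cuts (S m)) \<subseteq> set (cuts (S n))" if "m \<le> n" for m n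
    using that by (rule lift_Suc_mono_le[of "\<lambda>n. set (cuts (S n))", rotated]) (auto simp: step(3))
  \<comment> \<open>The cut of iteration \<open>i\<close> is present from state \<open>Suc i\<close>
    on, and \<open>i < j\<close> gives \<open>Suc i \<le> j\<close>.\<close>
  have "k \<in> set (cuts (S j))"
    using mono[of "Suc i" j] ij(1) by (auto simp: step(3) k_def)
  \<comment> \<open>The bound comes from feasibility of \<open>V j\<close>, not from its optimality,
    and so holds even in scenarios of probability 0.\<close>
  have "recourse I \<omega> (at_disruption I \<omega> (z j)) \<le> V j \<omega>" if "\<omega> \<in> scenarios I" for \<omega>
  proof -
    have "cut_bound I k \<omega> (z j) \<le> V j \<omega>"
      using step(1)[of j] \<open>k \<in> set (cuts (S j))\<close> that by (simp add: master_optimal_def master_feasible_alt)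
    then show ?thesis
      using cut_bound_tight[OF assms(1) that feas[of i], of "lam i" "z j"] step(2)[OF that]
        plan_key_at_disruption[OF assms(1) that ij(2)]
      by (simp add: k_def)
  qed
  then have "P_objective I (q j) (z j) \<le> LB (S (Suc j))"
    using assms(1) unfolding step(4) P_objective_def master_objective_def valid_grid_def
    by (intro sum_mono mult_left_mono add_left_mono) auto
  moreover have "alg_invariant I (S (Suc j))"
  proof -
    have "(alg_step I 0)\<^sup>*\<^sup>* alg_init (S n)" for n
      by (induction n) (use assms(2,3) in \<open>auto intro: rtranclp.rtrancl_into_rtrancl\<close>)
    then show ?thesis
      using alg_invariant_reachable[OF assms(1)] by blast
  qed
  \<comment> \<open>The minimum with a real number is not \<infinity>, and the invariant then makes
    it real.\<close>
  then have "\<exists>u. UB (S (Suc j)) = ereal u"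
    using step(5)[of j] unfolding alg_invariant_def by (auto simp: min_def split: if_splits)
  ultimately have "\<not> loop_guard 0 (S (Suc j))"
    using step(5)[of j] not_loop_guard_iff by (metis dual_order.trans ereal_less_eq(3) min.cobounded2)
  then show False
    using assms(3)[of "Suc j"] by (simp add: alg_step_def)
qed

text \<open>Since a step is a relation, absence of infinite runs would not exclude getting stuck
  inside the loop; progress under the guard is therefore part of the claim. Together they say that
  every maximal run ends with the guard false.\<close>

theorem theorem1:
  fixes I :: "('b, 'g, 'd, 's) grid"
  assumes "valid_grid I"
  shows "\<not> (\<exists>S. S 0 = alg_init \<and> (\<forall>k::nat. alg_step I 0 (S k) (S (Suc k)))) \<and>
         (\<forall>s. (alg_step I 0)\<^sup>*\<^sup>* alg_init s \<longrightarrow>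
            (loop_guard 0 s \<longrightarrow> (\<exists>s'. alg_step I 0 s s')) \<and>
            (\<not> loop_guard 0 s \<longrightarrow> (\<exists>z q. incumbent s = Some z \<and> P_optimal I q z)))"
proof (intro conjI allI impI)
  show "\<nexists>S. S 0 = alg_init \<and> (\<forall>k::nat. alg_step I 0 (S k) (S (Suc k)))"
    using alg_terminates[OF assms] by blast
next
  fix s :: "('b, 'g, 's) state"
  assume "loop_guard 0 s"
  then show "\<exists>s'. alg_step I 0 s s'"
    by (rule alg_progress[OF assms])
next
  fix s :: "('b, 'g, 's) state"
  assume "(alg_step I 0)\<^sup>*\<^sup>* alg_init s" "\<not> loop_guard 0 s"
  then show "\<exists>z q. incumbent s = Some z \<and> P_optimal I q z"
    using alg_exit_optimal[OF alg_invariant_reachable[OF assms]] by blast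
qed

end
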